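(* For every integer $d\geqslant 5$, the set of admissible monomials of weight vector $(2)|(1)|^{d-1}$ in $P_5$ all of whose exponents are positive is exactly $\{a_{d,1},\dots,a_{d,9}\}$, where $a_{d,1}=x_1x_2x_3^{2}x_4^{4}x_5^{2^d-8}$, $a_{d,2}=x_1x_2^{2}x_3x_4^{4}x_5^{2^d-8}$, $a_{d,3}=x_1x_2^{2}x_3^{4}x_4x_5^{2^d-8}$, $a_{d,4}=x_1x_2^{2}x_3^{4}x_4^{2^d-8}x_5$, $a_{d,5}=x_1x_2^{2}x_3^{4}x_4^{8}x_5^{2^d-15}$, $a_{d,6}=x_1x_2^{2}x_3^{4}x_4^{9}x_5^{2^d-16}$, $a_{d,7}=x_1x_2^{2}x_3^{5}x_4^{8}x_5^{2^d-16}$, $a_{d,8}=x_1x_2^{3}x_3^{4}x_4^{8}x_5^{2^d-16}$, $a_{d,9}=x_1^{3}x_2x_3^{4}x_4^{8}x_5^{2^d-16}$. Consequently $\dim QP_5^+((2)|(1)|^{d-1})=9$ and $\dim QP_5((2)|(1)|^{d-1})=124$.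
   Context: $P_k=\mathbb F_2[x_1,\dots,x_k]$, $\deg x_i=1$, with the standard action of the mod-2 Steenrod algebra $\mathcal A$; $\mathcal A^+$ is the augmentation ideal. For a monomial $x$, $\nu_j(x)$ is the exponent of $x_j$, $\alpha_i(a)$ the $i$-th binary digit of $a$, the weight vector is $\omega(x)=(\omega_i(x))_{i\ge1}$ with $\omega_i(x)=\sum_j\alpha_{i-1}(\nu_j(x))$, and the exponent vector is $\sigma(x)=(\nu_1(x),\dots,\nu_k(x))$; both are ordered left-lexicographically, and for monomials of equal degree $u<v$ iff $\omega(u)<\omega(v)$, or $\omega(u)=\omega(v)$ and $\sigma(u)<\sigma(v)$. A monomial $u$ is admissible unless there are monomials $v_1,\dots,v_r<u$ with $u+\sum v_j\in\mathcal A^+P_k$. For a weight vector $\omega$ of degree $\deg\omega=\sum_i2^{i-1}\omega_i$: $P_k(\omega)$ (resp. $P_k^-(\omega)$) is spanned by monomials $y$ with $\deg y=\deg\omega$ and $\omega(y)\le\omega$ (resp. $<\omega$); $QP_k(\omega)=P_k(\omega)/((\mathcal A^+P_k\cap P_k(\omega))+P_k^-(\omega))$; $P_k^+$ is the span of monomials with all exponents positive, and $QP_k^+(\omega)$ is the image of $P_k^+\cap P_k(\omega)$ in $QP_k(\omega)$. Notation: $(2)|(1)|^{d-1}=(2,1,\dots,1,0,\dots)$ with $d-1$ ones. *)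

theory Defs
  imports Main
begin

text \<open>Monomials of P_k = F_2[x_1,...,x_k] are exponent lists of length k
  (entry j-1 is the exponent of x_j).  Polynomials over F_2 are finite sets of
  monomials (the set of monomials with coefficient 1); addition is symmetric
  difference.\<close>

type_synonym mono = "nat list"
type_synonym poly = "mono set"

definition padd :: "poly \<Rightarrow> poly \<Rightarrow> poly" where
  "padd f g = (f - g) \<union> (g - f)"

definition f2_sum :: "poly set \<Rightarrow> poly" where
  "f2_sum B = {m. odd (card {p \<in> B. m \<in> p})}"

definition f2_span :: "poly set \<Rightarrow> poly set" where
  "f2_span S = {f2_sum B | B. finite B \<and> B \<subseteq> S}"

definition quot_dim :: "poly set \<Rightarrow> poly set \<Rightarrow> nat" where
  "quot_dim V W = (THE n. \<exists>B. finite B \<and> B \<subseteq> V \<and> card B = n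
       \<and> f2_span (B \<union> W) = V
       \<and> (\<forall>C. C \<subseteq> B \<longrightarrow> C \<noteq> {} \<longrightarrow> f2_sum C \<notin> W))"

text \<open>Action of Sq^i on a monomial via the Cartan formula and
  Sq^i(x^a) = binom(a,i) x^(a+i).\<close>
definition sq :: "nat \<Rightarrow> mono \<Rightarrow> poly" where
  "sq i e = {map2 (+) e t | t. length t = length e \<and> sum_list t = i
                \<and> (\<forall>j<length e. odd (e ! j choose t ! j))}"

text \<open>A^+ P_k: the span of all Sq^i(f), i > 0 (every element of A^+ is a
  sum of products Sq^a \<theta> with a > 0).\<close>
definition hit :: "nat \<Rightarrow> poly set" where
  "hit k = f2_span {sq i e | i e. 0 < i \<and> length e = k}"

definition mdeg :: "mono \<Rightarrow> nat" where
  "mdeg x = sum_list x"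

text \<open>Weight vector, 0-indexed: wt x i = omega_(i+1)(x) = sum_j alpha_i(nu_j(x)).\<close>
definition wt :: "mono \<Rightarrow> nat \<Rightarrow> nat" where
  "wt x i = (\<Sum>j<length x. (x ! j div 2 ^ i) mod 2)"

definition sigma :: "mono \<Rightarrow> nat \<Rightarrow> nat" where
  "sigma x j = (if j < length x then x ! j else 0)"

definition lex_less :: "(nat \<Rightarrow> nat) \<Rightarrow> (nat \<Rightarrow> nat) \<Rightarrow> bool" where
  "lex_less f g = (\<exists>m. f m < g m \<and> (\<forall>i<m. f i = g i))"

definition lex_le :: "(nat \<Rightarrow> nat) \<Rightarrow> (nat \<Rightarrow> nat) \<Rightarrow> bool" where
  "lex_le f g = (f = g \<or> lex_less f g)"

definition mono_less :: "nat \<Rightarrow> mono \<Rightarrow> mono \<Rightarrow> bool" where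
  "mono_less k u v = (length u = k \<and> length v = k \<and> mdeg u = mdeg v \<and>
     (lex_less (wt u) (wt v) \<or> (wt u = wt v \<and> lex_less (sigma u) (sigma v))))"

definition admissible :: "nat \<Rightarrow> mono \<Rightarrow> bool" where
  "admissible k u = (length u = k \<and>
     \<not> (\<exists>vs. (\<forall>v\<in>set vs. mono_less k v u) \<and>
            foldr padd (map (\<lambda>v. {v}) vs) {u} \<in> hit k))"

definition wdeg :: "(nat \<Rightarrow> nat) \<Rightarrow> nat" where
  "wdeg w = (\<Sum>i<Suc (Max ({0} \<union> {i. w i \<noteq> 0})). 2 ^ i * w i)"

definition Pw :: "nat \<Rightarrow> (nat \<Rightarrow> nat) \<Rightarrow> poly set" where
  "Pw k w = f2_span {{y} | y. length y = k \<and> mdeg y = wdeg w \<and> lex_le (wt y) w}"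

definition Pw_minus :: "nat \<Rightarrow> (nat \<Rightarrow> nat) \<Rightarrow> poly set" where
  "Pw_minus k w = f2_span {{y} | y. length y = k \<and> mdeg y = wdeg w \<and> lex_less (wt y) w}"

definition Pplus :: "nat \<Rightarrow> poly set" where
  "Pplus k = f2_span {{y} | y. length y = k \<and> (\<forall>j<k. 0 < y ! j)}"

definition QW :: "nat \<Rightarrow> (nat \<Rightarrow> nat) \<Rightarrow> poly set" where
  "QW k w = f2_span ((hit k \<inter> Pw k w) \<union> Pw_minus k w)"

definition dim_QP :: "nat \<Rightarrow> (nat \<Rightarrow> nat) \<Rightarrow> nat" where
  "dim_QP k w = quot_dim (Pw k w) (QW k w)"

text \<open>dim of QP_k^+(w): the image of P_k^+ \<inter> P_k(w) in QP_k(w), i.e.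
  ((P_k^+ \<inter> P_k(w)) + W)/W.\<close>
definition dim_QP_plus :: "nat \<Rightarrow> (nat \<Rightarrow> nat) \<Rightarrow> nat" where
  "dim_QP_plus k w = quot_dim (f2_span ((Pplus k \<inter> Pw k w) \<union> QW k w)) (QW k w)"

definition omega_d :: "nat \<Rightarrow> nat \<Rightarrow> nat" where
  "omega_d d i = (if i = 0 then 2 else if i < d then 1 else 0)"

end

theory Submission
  imports Defs
begin

text \<open>A monomial of weight \<open>(2)|(1)^(d-1)\<close> is \<open>x_i x_j\<close> times a word of \<open>d - 1\<close> letters, the
  letter at place \<open>t\<close> contributing its \<open>2^t\<close>-th power; monomials of smaller weight are squares, hence
  hit. The squares \<open>Sq^(2^t)\<close>, applied to \<open>Y v^(2^t)\<close> with \<open>deg Y = 2^t\<close>, show that modulo hit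
  polynomials only the pair \<open>{i, j}\<close> and the set \<open>S\<close> of letters matter, and \<open>Sq^1\<close> applied to
  \<open>x_i x_j x_l Z^4\<close> gives the relation \<open>(ij, S + l) + (il, S + j) + (jl, S + i) = 0\<close>.

  Conversely, for each support \<open>T\<close> and each variable \<open>m \<in> T\<close>, counting modulo 2 the monomials of degree
  \<open>2^d\<close> and support \<open>T\<close> whose \<open>m\<close>-th exponent is 1 (flag \<open>psi\<close>), or is odd and greater than 1
  (flag \<open>theta\<close>), kills all hit polynomials: by Vandermonde's identity the contributions sum to
  \<open>binom(a, b)\<close> with \<open>a + b = 2^d - 1\<close> and \<open>b > 0\<close>, which is even. In terms of its two flags the relation
  above is additive, so the support \<open>T\<close> contributes dimension \<open>2 |T| - 1\<close>. The listed monomials are the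
  least monomials carrying a given flag other than \<open>psi\<close> at \<open>x_1\<close>.\<close>

subsection \<open>Linear algebra over the two-element field\<close>

text \<open>Picture the 2 |T| flags of a support \<open>T\<close> as vertices and a monomial as the
  edge joining the flags of its two odd exponents. The relation with letters \<open>S\<close> is the
  triangle on the flags that \<open>S\<close> prescribes at i, j, l. Modulo triangles every edge is
  a sum of edges of a spanning tree, whence the upper bound. It is attained: each monomial carries
  exactly two flags, so the flag functionals of one support satisfy a single linear relation. The
  tree used is the star at \<open>psi\<close> of a variable \<open>a\<close>, with one more edge
  from \<open>theta\<close> at \<open>a\<close> to \<open>psi\<close> of a second variable
  \<open>s\<close>. The nine monomials form this tree for a = x_1 and s = x_2, rooted at
  \<open>psi\<close> of x_1; this is why that flag has no monomial of its own. Supports do not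
  interact: an odd binomial coefficient e over t forces t \<le> e, so squares create no new
  variables. Two boundary cases shape the argument: the triangle with \<open>S\<close> empty is not
  given directly by a square, and a support with two variables has no triangles and lacks one
  edge.\<close>

lemma padd_simps [simp]: "padd f {} = f" "padd {} f = f" "padd f f = {}" "padd f (padd f g) = g"
  by (auto simp: padd_def)

lemma padd_commute: "padd f g = padd g f"
  by (auto simp: padd_def)

lemma padd_assoc: "padd (padd f g) h = padd f (padd g h)"
  by (auto simp: padd_def)

lemma padd_left_commute: "padd f (padd g h) = padd g (padd f h)"
  by (auto simp: padd_def)

lemmas padd_ac = padd_assoc padd_commute padd_left_commute

lemma finite_padd: "finite f \<Longrightarrow> finite g \<Longrightarrow> finite (padd f g)"
  by (auto simp: padd_def)

lemma padd_subset: "f \<subseteq> A \<Longrightarrow> g \<subseteq> A \<Longrightarrow> padd f g \<subseteq> A"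
  by (auto simp: padd_def)

lemma f2_sum_empty [simp]: "f2_sum {} = {}"
  by (simp add: f2_sum_def)

lemma f2_sum_insert:
  assumes "finite B" "s \<notin> B"
  shows "f2_sum (insert s B) = padd s (f2_sum B)"
proof -
  have *: "{p \<in> insert s B. m \<in> p} = (if m \<in> s then insert s {p \<in> B. m \<in> p} else {p \<in> B. m \<in> p})" for m
    by auto
  show ?thesis
    using assms unfolding f2_sum_def padd_def * by auto
qed

lemma f2_sum_Un:
  assumes "finite A" "finite B" "A \<inter> B = {}"
  shows "f2_sum (A \<union> B) = padd (f2_sum A) (f2_sum B)"
  using assms by (induction A) (auto simp: f2_sum_insert padd_assoc)

text \<open>Members of \<open>A \<inter> B\<close> occur in both sums and cancel.\<close>

lemma f2_sum_symdiff:
  assumes "finite A" "finite B"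
  shows "f2_sum ((A - B) \<union> (B - A)) = padd (f2_sum A) (f2_sum B)"
proof -
  have "(A - B) \<union> (A \<inter> B) = A" "(B - A) \<union> (A \<inter> B) = B" by blast+
  moreover have "(A - B) \<inter> (A \<inter> B) = {}" "(B - A) \<inter> (A \<inter> B) = {}" by blast+
  ultimately have A: "f2_sum A = padd (f2_sum (A - B)) (f2_sum (A \<inter> B))"
    and B: "f2_sum B = padd (f2_sum (B - A)) (f2_sum (A \<inter> B))"
    using f2_sum_Un[of "A - B" "A \<inter> B"] f2_sum_Un[of "B - A" "A \<inter> B"] assms
    by (metis finite_Diff finite_Int)+
  have "f2_sum ((A - B) \<union> (B - A)) = padd (f2_sum (A - B)) (f2_sum (B - A))"
    by (rule f2_sum_Un) (use assms in auto)
  then show ?thesis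
    unfolding A B by (simp add: padd_ac)
qed

lemma f2_span_induct [consumes 1, case_names zero add]:
  assumes "f \<in> f2_span S" "P {}" "\<And>s f. s \<in> S \<Longrightarrow> f \<in> f2_span S \<Longrightarrow> P f \<Longrightarrow> P (padd s f)"
  shows "P f"
proof -
  obtain B where B: "finite B" "B \<subseteq> S" "f = f2_sum B"
    using assms(1) by (auto simp: f2_span_def)
  from B(1,2) have "P (f2_sum B)"
  proof (induction B)
    case (insert s B)
    then have "f2_sum B \<in> f2_span S"
      unfolding f2_span_def by blast
    with insert show ?case by (simp add: f2_sum_insert assms(3))
  qed (simp add: assms(2))
  with B(3) show ?thesis by simp
qed

lemma f2_span_zero: "{} \<in> f2_span S"
  unfolding f2_span_def by (intro CollectI exI[of _ "{}"]) simp

lemma f2_span_superset: "s \<in> S \<Longrightarrow> s \<in> f2_span S"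
  unfolding f2_span_def
  by (intro CollectI exI[of _ "{s}"] conjI) (auto simp: f2_sum_insert)

lemma f2_span_padd:
  assumes "f \<in> f2_span S" "g \<in> f2_span S"
  shows "padd f g \<in> f2_span S"
proof -
  obtain A B where "finite A" "A \<subseteq> S" "f = f2_sum A" "finite B" "B \<subseteq> S" "g = f2_sum B"
    using assms by (auto simp: f2_span_def)
  then show ?thesis
    unfolding f2_span_def
    by (intro CollectI exI[of _ "(A - B) \<union> (B - A)"] conjI) (auto simp: f2_sum_symdiff)
qed

definition f2_subspace :: "poly set \<Rightarrow> bool" where
  "f2_subspace W \<longleftrightarrow> {} \<in> W \<and> (\<forall>f\<in>W. \<forall>g\<in>W. padd f g \<in> W)"

lemma f2_subspace_span: "f2_subspace (f2_span S)"
  by (auto simp: f2_subspace_def f2_span_zero f2_span_padd)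

lemma f2_subspace_Int: "f2_subspace V \<Longrightarrow> f2_subspace W \<Longrightarrow> f2_subspace (V \<inter> W)"
  by (simp add: f2_subspace_def)

lemma f2_span_least:
  assumes "f2_subspace W" "S \<subseteq> W"
  shows "f2_span S \<subseteq> W"
proof
  fix f assume "f \<in> f2_span S"
  then show "f \<in> W"
  proof (induction rule: f2_span_induct)
    case (add s f)
    then show ?case
      using assms unfolding f2_subspace_def by (meson subsetD)
  qed (use assms in \<open>simp add: f2_subspace_def\<close>)
qed

lemma f2_span_subspace: "f2_subspace W \<Longrightarrow> f2_span W = W"
  using f2_span_least[of W W] f2_span_superset[of _ W] by (intro equalityI subsetI) auto

lemma f2_span_mono: "S \<subseteq> S' \<Longrightarrow> f2_span S \<subseteq> f2_span S'"
  unfolding f2_span_def by blast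

lemma f2_sum_singletons: "f2_sum ((\<lambda>y. {y}) ` C) = C"
proof -
  have "{p \<in> (\<lambda>y. {y}) ` C. m \<in> p} = (if m \<in> C then {{m}} else {})" for m
    by auto
  then show ?thesis
    unfolding f2_sum_def by auto
qed

lemma f2_span_singletons: "f2_span ((\<lambda>y. {y}) ` Y) = {f. finite f \<and> f \<subseteq> Y}"
proof
  show "f2_span ((\<lambda>y. {y}) ` Y) \<subseteq> {f. finite f \<and> f \<subseteq> Y}"
    by (rule f2_span_least) (auto simp: f2_subspace_def padd_def)
  show "{f. finite f \<and> f \<subseteq> Y} \<subseteq> f2_span ((\<lambda>y. {y}) ` Y)"
  proof
    fix f assume "f \<in> {f. finite f \<and> f \<subseteq> Y}"
    then show "f \<in> f2_span ((\<lambda>y. {y}) ` Y)"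
      unfolding f2_span_def
      by (intro CollectI exI[of _ "(\<lambda>y. {y}) ` f"]) (auto simp: f2_sum_singletons)
  qed
qed

text \<open>A basis of \<open>V\<close> modulo \<open>W\<close> identifies \<open>V\<close> with \<open>Pow B \<times> W\<close>, so its size is
  determined by the cardinalities of the finite sets \<open>V\<close> and \<open>W\<close>.\<close>

lemma quot_dim_eq_card:
  assumes W: "f2_subspace W" "finite W"
    and B: "finite B" "B \<subseteq> V" "f2_span (B \<union> W) = V"
      "\<And>C. C \<subseteq> B \<Longrightarrow> C \<noteq> {} \<Longrightarrow> f2_sum C \<notin> W"
  shows "quot_dim V W = card B"
proof -
  have card_V: "card V = 2 ^ card D * card W"
    if D: "finite D" "f2_span (D \<union> W) = V"
      "\<forall>C. C \<subseteq> D \<longrightarrow> C \<noteq> {} \<longrightarrow> f2_sum C \<notin> W" for D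
  proof -
    have "bij_betw (\<lambda>p. padd (f2_sum (fst p)) (snd p)) (Pow D \<times> W) V"
      unfolding bij_betw_def
    proof (intro conjI inj_onI)
      fix p q
      assume p: "p \<in> Pow D \<times> W" and q: "q \<in> Pow D \<times> W"
        and eq: "padd (f2_sum (fst p)) (snd p) = padd (f2_sum (fst q)) (snd q)"
      obtain C w where pC: "p = (C, w)" by force
      obtain C' w' where qC: "q = (C', w')" by force
      have sub: "C \<subseteq> D" "C' \<subseteq> D" "w \<in> W" "w' \<in> W"
        using p q pC qC by auto
      then have fin: "finite C" "finite C'"
        using D(1) finite_subset by auto
      have e: "padd (f2_sum C) w = padd (f2_sum C') w'"
        using eq pC qC by simp
      have "padd (f2_sum C) (f2_sum C') = padd w w'"
        using arg_cong[OF e, of "\<lambda>z. padd z (padd w (f2_sum C'))"] by (simp add: padd_ac)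
      \<comment> \<open>Two representations of one element differ by a sum over a symmetric
        difference that lies in \<open>W\<close>; independence modulo \<open>W\<close> makes that
        difference empty.\<close>
      then have "f2_sum ((C - C') \<union> (C' - C)) \<in> W"
        using fin sub W(1) by (simp add: f2_sum_symdiff f2_subspace_def)
      moreover have "(C - C') \<union> (C' - C) \<subseteq> D"
        using sub by auto
      ultimately have "(C - C') \<union> (C' - C) = {}"
        using D(3)[rule_format, of "(C - C') \<union> (C' - C)"] by auto
      then have CC: "C = C'" by blast
      have "padd (f2_sum C) (padd (f2_sum C) w) = padd (f2_sum C) (padd (f2_sum C) w')"
        using e by (simp only: CC)
      then have "w = w'" by (simp only: padd_simps)
      then show "p = q"
        using pC qC CC by simp
    next
      show "(\<lambda>p. padd (f2_sum (fst p)) (snd p)) ` (Pow D \<times> W) = V"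
      proof (intro equalityI subsetI)
        fix f assume "f \<in> (\<lambda>p. padd (f2_sum (fst p)) (snd p)) ` (Pow D \<times> W)"
        then obtain C w where C: "C \<subseteq> D" "w \<in> W" "f = padd (f2_sum C) w"
          by auto
        have "f2_sum C \<in> f2_span (D \<union> W)"
          unfolding f2_span_def
          by (intro CollectI exI[of _ C] conjI) (use C(1) D(1) in \<open>auto intro: finite_subset\<close>)
        moreover have "w \<in> f2_span (D \<union> W)"
          using C(2) by (auto intro: f2_span_superset)
        ultimately show "f \<in> V"
          unfolding C(3) D(2)[symmetric] by (rule f2_span_padd)
      next
        fix f assume "f \<in> V"
        then obtain E where E: "finite E" "E \<subseteq> D \<union> W" "f = f2_sum E"
          unfolding D(2)[symmetric] f2_span_def by blast
        have "f = padd (f2_sum (E \<inter> D)) (f2_sum (E - D))"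
          using f2_sum_Un[of "E \<inter> D" "E - D"] E by (simp add: Int_Diff_Un Int_Diff_disjoint)
        moreover have "f2_sum (E - D) \<in> f2_span W"
          unfolding f2_span_def
          by (intro CollectI exI[of _ "E - D"] conjI) (use E in auto)
        ultimately show "f \<in> (\<lambda>p. padd (f2_sum (fst p)) (snd p)) ` (Pow D \<times> W)"
          unfolding f2_span_subspace[OF W(1)]
          by (intro image_eqI[of _ _ "(E \<inter> D, f2_sum (E - D))"]) simp_all
      qed
    qed
    from bij_betw_same_card[OF this] show ?thesis
      using D(1) by (simp add: card_cartesian_product card_Pow)
  qed
  have "card W > 0"
    using W by (auto simp: f2_subspace_def card_gt_0_iff)
  show ?thesis
    unfolding quot_dim_def
  proof (rule the_equality)
    show "\<exists>D. finite D \<and> D \<subseteq> V \<and> card D = card B \<and> f2_span (D \<union> W) = V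
       \<and> (\<forall>C. C \<subseteq> D \<longrightarrow> C \<noteq> {} \<longrightarrow> f2_sum C \<notin> W)"
      by (intro exI[of _ B] conjI allI impI B refl)
  next
    fix n
    assume "\<exists>D. finite D \<and> D \<subseteq> V \<and> card D = n \<and> f2_span (D \<union> W) = V
       \<and> (\<forall>C. C \<subseteq> D \<longrightarrow> C \<noteq> {} \<longrightarrow> f2_sum C \<notin> W)"
    then obtain D where D: "finite D" "card D = n" "f2_span (D \<union> W) = V"
      "\<forall>C. C \<subseteq> D \<longrightarrow> C \<noteq> {} \<longrightarrow> f2_sum C \<notin> W" by blast
    have "card V = 2 ^ card B * card W"
      by (rule card_V) (simp_all add: B)
    moreover have "card V = 2 ^ n * card W"
      using card_V[OF D(1,3,4)] D(2) by simp
    ultimately show "n = card B"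
      using \<open>card W > 0\<close> by simp
  qed
qed

section \<open>Parity functionals and hit polynomials\<close>

definition par :: "(mono \<Rightarrow> bool) \<Rightarrow> poly \<Rightarrow> bool" where
  "par P f \<longleftrightarrow> odd (card {x \<in> f. P x})"

lemma par_empty [simp]: "\<not> par P {}"
  by (simp add: par_def)

lemma par_singleton [simp]: "par P {x} \<longleftrightarrow> P x"
  by (cases "P x") (auto simp: par_def Collect_conv_if)

text \<open>Truth values stand for the elements of the two-element field and \<open>\<noteq>\<close>
  for their addition, so this is the linearity of the functional that is 1 exactly on the monomials
  satisfying \<open>P\<close>.\<close>

lemma par_padd:
  assumes "finite f" "finite g"
  shows "par P (padd f g) \<longleftrightarrow> par P f \<noteq> par P g"
proof -
  let ?F = "{x \<in> f. P x}" and ?G = "{x \<in> g. P x}"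
  have "{x \<in> padd f g. P x} = (?F - ?G) \<union> (?G - ?F)"
    by (auto simp: padd_def)
  moreover have "card ((?F - ?G) \<union> (?G - ?F)) = card (?F - ?G) + card (?G - ?F)"
    by (rule card_Un_disjoint) (use assms in auto)
  moreover have "card ?F = card (?F - ?G) + card (?F \<inter> ?G)"
    using card_Int_Diff[of ?F ?G] assms by simp
  moreover have "card ?G = card (?G - ?F) + card (?F \<inter> ?G)"
    using card_Int_Diff[of ?G ?F] assms by (simp add: Int_commute)
  ultimately show ?thesis
    unfolding par_def by simp presburger
qed

lemma foldr_padd_finite: "finite X \<Longrightarrow> finite (foldr padd (map (\<lambda>v. {v}) vs) X)"
  by (induction vs) (auto intro: finite_padd)

text \<open>Repeated entries of \<open>vs\<close> cancel in pairs in the polynomial and change the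
  count by an even number, so the parity can be read off the list, the form in which admissibility
  presents a sum.\<close>

lemma foldr_padd_par:
  "finite X \<Longrightarrow> par P (foldr padd (map (\<lambda>v. {v}) vs) X) \<longleftrightarrow> odd (length (filter P vs)) \<noteq> par P X"
  by (induction vs) (auto simp: par_padd foldr_padd_finite)

lemma hit_zero: "{} \<in> hit k"
  by (simp add: hit_def f2_span_zero)

lemma hit_padd: "f \<in> hit k \<Longrightarrow> g \<in> hit k \<Longrightarrow> padd f g \<in> hit k"
  by (simp add: hit_def f2_span_padd)

lemma sq_in_hit: "0 < i \<Longrightarrow> length e = k \<Longrightarrow> sq i e \<in> hit k"
  unfolding hit_def by (rule f2_span_superset) blast

lemma hit_padd_iff: "g \<in> hit k \<Longrightarrow> padd f g \<in> hit k \<longleftrightarrow> f \<in> hit k"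
  by (metis hit_padd padd_commute padd_simps(4))

lemma sq_finite: "finite (sq i e)"
proof -
  have "sq i e \<subseteq> map2 (+) e ` {t. set t \<subseteq> {..i} \<and> length t = length e}"
    unfolding sq_def by (auto dest: member_le_sum_list)
  moreover have "finite {t. set t \<subseteq> {..i} \<and> length t = length e}"
    by (rule finite_lists_length_eq) simp
  ultimately show ?thesis
    using finite_subset finite_imageI by blast
qed

lemma hit_finite: "f \<in> hit k \<Longrightarrow> finite f"
  unfolding hit_def
  by (induction rule: f2_span_induct) (auto intro: finite_padd sq_finite)

lemma hit_par_vanish:
  assumes "f \<in> hit k" "\<And>i e. 0 < i \<Longrightarrow> length e = k \<Longrightarrow> \<not> par P (sq i e)"
  shows "\<not> par P f"
  using assms(1) unfolding hit_def
proof (induction rule: f2_span_induct)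
  case (add s f)
  then have "finite f" by (simp add: hit_finite[of f k] hit_def)
  with add show ?case
    using assms(2) sq_finite by (auto simp: par_padd)
qed simp

subsection \<open>Binomial coefficients modulo 2 and hit polynomials\<close>

text \<open>Lucas's theorem modulo 2 for the last binary digit; iterated, it says that the digits of
  \<open>k\<close> are bounded by those of \<open>n\<close>.\<close>

lemma odd_binomial_div2:
  "odd (n choose k) \<longleftrightarrow> odd ((n div 2) choose (k div 2)) \<and> (odd k \<longrightarrow> odd n)"
proof (induction n arbitrary: k rule: nat_less_induct)
  case (1 n)
  show ?case
  proof (cases "n < 2")
    case True
    then have "n = 0 \<or> n = 1" by auto
    moreover have "k = 0 \<or> k = 1 \<or> (k \<ge> 2 \<and> 1 < k \<and> 0 < k div 2)" by auto
    ultimately show ?thesis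
      by (auto simp: binomial_eq_0 dest: odd_pos)
  next
    case False
    then obtain m where n: "n = Suc (Suc m)"
      by (metis add_2_eq_Suc le_Suc_ex not_less)
    consider "k = 0" | "k = 1" | j where "k = Suc (Suc j)"
      by (metis One_nat_def not0_implies_Suc)
    then show ?thesis
    proof cases
      case 3
      \<comment> \<open>Pascal's rule applied twice: the middle coefficient
        \<open>m choose (j + 1)\<close> occurs twice and drops out.\<close>
      have "odd (n choose k) \<longleftrightarrow> odd (m choose j) \<noteq> odd (m choose k)"
        unfolding n 3 by auto
      also have "\<dots> \<longleftrightarrow> (odd ((m div 2) choose (j div 2)) \<noteq> odd ((m div 2) choose (k div 2)))
          \<and> (odd k \<longrightarrow> odd n)"
        using 1[rule_format, of m j] 1[rule_format, of m k] n 3 by auto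
      also have "\<dots> \<longleftrightarrow> odd ((n div 2) choose (k div 2)) \<and> (odd k \<longrightarrow> odd n)"
        unfolding n 3 by auto
      finally show ?thesis .
    qed (use n in auto)
  qed
qed

lemma odd_binomial_le: "odd (n choose k) \<Longrightarrow> k \<le> n"
  by (rule ccontr) (simp add: binomial_eq_0)

text \<open>Since \<open>2 ^ d - 1\<close> has only digits 1, the digits of \<open>a\<close> and
  \<open>b\<close> are complementary; where \<open>b\<close> has a 1, \<open>a\<close> has a
  0.\<close>

lemma even_binomial_complementary:
  "a + b = 2 ^ d - 1 \<Longrightarrow> 0 < b \<Longrightarrow> even (a choose b)"
proof (induction d arbitrary: a b)
  case (Suc d)
  have e: "odd (a + b)" using Suc.prems(1) by simp
  show ?case
  proof (cases "odd b")
    case True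
    then show ?thesis using e odd_binomial_div2[of a b] by auto
  next
    case False
    then obtain b' where b: "b = 2 * b'" by (auto elim: evenE)
    with e obtain a' where a: "a = 2 * a' + 1" by (auto elim: oddE)
    have "a' + b' = 2 ^ d - 1" "0 < b'" using Suc.prems a b by auto
    then have "even (a' choose b')" by (rule Suc.IH)
    then show ?thesis
      using a b odd_binomial_div2[of a b] by auto
  qed
qed simp

text \<open>The digits of \<open>y + 2 ^ t * v\<close> below place \<open>t\<close> are those of
  \<open>y\<close>, and its digit at place \<open>t\<close> is the last digit of \<open>v\<close>;
  the only \<open>s\<close> reaching that place is \<open>2 ^ t\<close>.\<close>

lemma odd_binomial_add_pow2_mult:
  assumes "y < 2 ^ t" "s \<le> 2 ^ t"
  shows "odd ((y + 2 ^ t * v) choose s) \<longleftrightarrow>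
    (if s < 2 ^ t then odd (y choose s) else odd v)"
  using assms
proof (induction t arbitrary: y s)
  case 0
  then consider "s = 0" | "s = 1" by fastforce
  then show ?case using 0 by cases auto
next
  case (Suc t)
  have 1: "(y + 2 ^ Suc t * v) div 2 = y div 2 + 2 ^ t * v" "odd (y + 2 ^ Suc t * v) = odd y"
    by auto
  have 2: "s div 2 < 2 ^ t \<longleftrightarrow> s < 2 ^ Suc t"
    by auto
  have 3: "s = 2 ^ Suc t" if "\<not> s < 2 ^ Suc t"
    using that Suc.prems by auto
  have "odd ((y + 2 ^ Suc t * v) choose s) \<longleftrightarrow>
      odd ((y div 2 + 2 ^ t * v) choose (s div 2)) \<and> (odd s \<longrightarrow> odd y)"
    by (subst odd_binomial_div2) (simp only: 1)
  also have "\<dots> \<longleftrightarrow> (if s div 2 < 2 ^ t then odd ((y div 2) choose (s div 2)) else odd v) \<and> (odd s \<longrightarrow> odd y)"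
    using Suc.IH[of "y div 2" "s div 2"] Suc.prems by auto
  also have "\<dots> \<longleftrightarrow> (if s < 2 ^ Suc t then odd (y choose s) else odd v)"
    unfolding 2 using 3 odd_binomial_div2[of y s] by auto
  finally show ?case .
qed

section \<open>Squares of monomials through the Cartan formula\<close>

lemma sq_map:
  "sq i (map f [0..<k]) = {map (\<lambda>m. f m + t m) [0..<k] | t.
     (\<Sum>m<k. t m) = i \<and> (\<forall>m<k. odd (f m choose t m))}" (is "?L = ?R")
proof (intro equalityI subsetI)
  fix x assume "x \<in> ?L"
  then obtain t where t: "x = map2 (+) (map f [0..<k]) t" "length t = k" "sum_list t = i"
    "\<forall>m<k. odd (f m choose t ! m)"
    unfolding sq_def by auto
  have "x = map (\<lambda>m. f m + t ! m) [0..<k]"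
    using t by (intro nth_equalityI) auto
  moreover have "(\<Sum>m<k. t ! m) = i"
    using t by (simp add: sum_list_sum_nth atLeast0LessThan)
  ultimately show "x \<in> ?R" using t by blast
next
  fix x assume "x \<in> ?R"
  then obtain t where t: "x = map (\<lambda>m. f m + t m) [0..<k]" "(\<Sum>m<k. t m) = i"
    "\<forall>m<k. odd (f m choose t m)"
    by auto
  have "x = map2 (+) (map f [0..<k]) (map t [0..<k])"
    unfolding t(1) by (intro nth_equalityI) auto
  moreover have "sum_list (map t [0..<k]) = i"
    using t(2) by (simp add: sum_list_sum_nth atLeast0LessThan)
  ultimately show "x \<in> ?L"
    unfolding sq_def using t(3)
    by (intro CollectI exI[of _ "map t [0..<k]"]) auto
qed

lemma map_upt_eq_iff: "map f [0..<k] = map g [0..<k] \<longleftrightarrow> (\<forall>m<k. f m = g m)"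
  by auto

lemma sum_nat_eq_one_cases:
  fixes t :: "nat \<Rightarrow> nat"
  assumes "(\<Sum>m<k. t m) = N" "j < k" "t j = N"
  shows "\<forall>m<k. t m = (if m = j then N else 0)"
proof -
  have "(\<Sum>m\<in>{..<k} - {j}. t m) = 0"
    using assms by (simp add: sum.remove[of "{..<k}" j])
  then show ?thesis using assms by auto
qed

lemma sq_1_map:
  "sq 1 (map f [0..<k]) = {map (\<lambda>m. f m + of_bool (m = j)) [0..<k] | j. j < k \<and> odd (f j)}"
  unfolding sq_map
proof (intro equalityI subsetI)
  fix x assume "x \<in> {map (\<lambda>m. f m + t m) [0..<k] | t.
     (\<Sum>m<k. t m) = 1 \<and> (\<forall>m<k. odd (f m choose t m))}"
  then obtain t where t: "x = map (\<lambda>m. f m + t m) [0..<k]" "(\<Sum>m<k. t m) = 1"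
    "\<forall>m<k. odd (f m choose t m)" by auto
  then obtain j where j: "j < k" "t j = 1"
    using sum_eq_1_iff[of "{..<k}" t] by blast
  have "\<forall>m<k. t m = (if m = j then 1 else 0)"
    by (rule sum_nat_eq_one_cases) (use t j in auto)
  moreover have "odd (f j)"
    using t(3) j by auto
  ultimately show "x \<in> {map (\<lambda>m. f m + of_bool (m = j)) [0..<k] | j. j < k \<and> odd (f j)}"
    using j t(1) by (auto simp: map_upt_eq_iff)
next
  fix x assume "x \<in> {map (\<lambda>m. f m + of_bool (m = j)) [0..<k] | j. j < k \<and> odd (f j)}"
  then obtain j where "x = map (\<lambda>m. f m + of_bool (m = j)) [0..<k]" "j < k" "odd (f j)" by auto
  then show "x \<in> {map (\<lambda>m. f m + t m) [0..<k] | t.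
     (\<Sum>m<k. t m) = 1 \<and> (\<forall>m<k. odd (f m choose t m))}"
    by (intro CollectI exI[of _ "\<lambda>m. of_bool (m = j)"]) auto
qed

text \<open>The square of a monomial is \<open>Sq^N\<close> of it, \<open>N\<close> being its
  degree: a Cartan term needs \<open>t \<le> f\<close> everywhere and equal sums, hence
  \<open>t = f\<close>.\<close>

lemma all_even_hit:
  assumes "0 < (\<Sum>m<k. f m)"
  shows "{map (\<lambda>m. 2 * f m) [0..<k]} \<in> hit k"
proof -
  have "sq (\<Sum>m<k. f m) (map f [0..<k]) = {map (\<lambda>m. 2 * f m) [0..<k]}"
    unfolding sq_map
  proof (intro equalityI subsetI)
    fix x assume "x \<in> {map (\<lambda>m. f m + t m) [0..<k] | t.
       (\<Sum>m<k. t m) = (\<Sum>m<k. f m) \<and> (\<forall>m<k. odd (f m choose t m))}"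
    then obtain t where t: "x = map (\<lambda>m. f m + t m) [0..<k]" "(\<Sum>m<k. t m) = (\<Sum>m<k. f m)"
      "\<forall>m<k. odd (f m choose t m)" by auto
    have "t m \<le> f m" if "m < k" for m
      by (rule odd_binomial_le[OF t(3)[rule_format, OF that]])
    then have "t m = f m" if "m < k" for m
      using that by (intro sum_mono_inv[of t "{..<k}" f]) (simp_all add: t(2))
    then show "x \<in> {map (\<lambda>m. 2 * f m) [0..<k]}"
      using t(1) by auto
  next
    fix x assume "x \<in> {map (\<lambda>m. 2 * f m) [0..<k]}"
    then show "x \<in> {map (\<lambda>m. f m + t m) [0..<k] | t.
       (\<Sum>m<k. t m) = (\<Sum>m<k. f m) \<and> (\<forall>m<k. odd (f m choose t m))}"
      by (intro CollectI exI[of _ f]) simp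
  qed
  then show ?thesis
    using sq_in_hit[OF assms, of "map f [0..<k]" k] by simp
qed

text \<open>The degree of \<open>Y\<close> equals the order of the square, so the Cartan formula leaves, besides
  \<open>Y (Sq^1 v)^(2^t)\<close>, only the square \<open>Y^2 v^(2^t)\<close>, which is hit.\<close>

lemma mult_pow_Sq1_hit:
  assumes t: "0 < t" and Y: "(\<Sum>m<k. Y m) = 2 ^ t" "\<forall>m<k. Y m < 2 ^ t"
  shows "{map (\<lambda>m. Y m + 2 ^ t * (v m + of_bool (m = j))) [0..<k] | j. j < k \<and> odd (v j)} \<in> hit k"
    (is "?A \<in> _")
proof -
  let ?f = "\<lambda>m. Y m + 2 ^ t * v m"
  define z where "z = map (\<lambda>m. 2 * Y m + 2 ^ t * v m) [0..<k]"
  obtain s where s: "t = Suc s" using t gr0_conv_Suc by auto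
  have "z = map (\<lambda>m. 2 * (Y m + 2 ^ s * v m)) [0..<k]"
    unfolding z_def s by (simp add: algebra_simps)
  \<comment> \<open>Here \<open>0 < t\<close> enters: the factor \<open>v^(2^t)\<close> is itself a
    square.\<close>
  then have z_hit: "{z} \<in> hit k"
    using all_even_hit[of "\<lambda>m. Y m + 2 ^ s * v m" k] Y(1) by (simp add: sum.distrib)
  have "sq (2 ^ t) (map ?f [0..<k]) = insert z ?A"
    unfolding sq_map
  proof (intro equalityI subsetI)
    fix x assume "x \<in> {map (\<lambda>m. ?f m + r m) [0..<k] | r.
       (\<Sum>m<k. r m) = 2 ^ t \<and> (\<forall>m<k. odd (?f m choose r m))}"
    then obtain r where r: "x = map (\<lambda>m. ?f m + r m) [0..<k]" "(\<Sum>m<k. r m) = 2 ^ t"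
      "\<forall>m<k. odd (?f m choose r m)" by auto
    have le: "r m \<le> 2 ^ t" if "m < k" for m
      using r(2) that member_le_sum[of m "{..<k}" r] by auto
    \<comment> \<open>If some entry of \<open>r\<close> equals \<open>2 ^ t\<close>, the whole
      degree sits there and acts as \<open>Sq^1\<close> on \<open>v\<close>. Otherwise only digits
      below place \<open>t\<close> matter, so \<open>r \<le> Y\<close>, and equal sums give
      \<open>r = Y\<close>.\<close>
    show "x \<in> insert z ?A"
    proof (cases "\<exists>j<k. r j = 2 ^ t")
      case True
      then obtain j where j: "j < k" "r j = 2 ^ t" by auto
      then have "\<forall>m<k. r m = (if m = j then 2 ^ t else 0)"
        using sum_nat_eq_one_cases r(2) by blast
      then have "x = map (\<lambda>m. Y m + 2 ^ t * (v m + of_bool (m = j))) [0..<k]"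
        unfolding r(1) map_upt_eq_iff by (simp add: algebra_simps)
      moreover have "odd (v j)"
        using odd_binomial_add_pow2_mult[of "Y j" t "2 ^ t" "v j"] r(3)[rule_format, OF j(1)] j Y(2)
        by simp
      ultimately show ?thesis using j by blast
    next
      case False
      then have lt: "r m < 2 ^ t" if "m < k" for m
        using le that by (meson le_neq_implies_less)
      then have "odd (Y m choose r m)" if "m < k" for m
        using odd_binomial_add_pow2_mult[of "Y m" t "r m" "v m"] r(3)[rule_format, OF that]
          lt[OF that] Y(2) that by simp
      then have "r m \<le> Y m" if "m < k" for m
        using that odd_binomial_le by metis
      then have "r m = Y m" if "m < k" for m
        using that by (intro sum_mono_inv[of r "{..<k}" Y]) (simp_all add: r(2) Y(1))
      then have "x = z"
        unfolding r(1) z_def by auto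
      then show ?thesis by simp
    qed
  next
    fix x assume "x \<in> insert z ?A"
    then consider "x = z" | j where "j < k" "odd (v j)"
        "x = map (\<lambda>m. Y m + 2 ^ t * (v m + of_bool (m = j))) [0..<k]" by auto
    then show "x \<in> {map (\<lambda>m. ?f m + r m) [0..<k] | r.
       (\<Sum>m<k. r m) = 2 ^ t \<and> (\<forall>m<k. odd (?f m choose r m))}"
    proof cases
      case 1
      have "odd (?f m choose Y m)" if "m < k" for m
        using Y(2) that odd_binomial_add_pow2_mult[of "Y m" t "Y m" "v m"] by (simp add: less_imp_le)
      then show ?thesis
        using 1 Y(1) by (intro CollectI exI[of _ Y]) (simp add: z_def)
    next
      case 2
      then have "odd (?f m choose (2 ^ t * of_bool (m = j)))" if "m < k" for m
        using that Y(2) odd_binomial_add_pow2_mult[of "Y j" t "2 ^ t" "v j"] by (cases "m = j") simp_all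
      moreover have "x = map (\<lambda>m. ?f m + 2 ^ t * of_bool (m = j)) [0..<k]"
        unfolding 2(3) map_upt_eq_iff by (simp add: algebra_simps)
      moreover have "(\<Sum>m<k. 2 ^ t * of_bool (m = j)) = (2 ^ t :: nat)"
        using 2(1) by (simp add: sum_distrib_left[symmetric])
      ultimately show ?thesis
        by (intro CollectI exI[of _ "\<lambda>m. 2 ^ t * of_bool (m = j)"]) simp
    qed
  qed
  \<comment> \<open>Ensures that adding \<open>{z}\<close> to the square leaves exactly
    \<open>?A\<close>; a coincidence is ruled out by \<open>Y j < 2 ^ t\<close>.\<close>
  moreover have "z \<notin> ?A"
  proof
    assume "z \<in> ?A"
    then obtain j where j: "j < k" "z = map (\<lambda>m. Y m + 2 ^ t * (v m + of_bool (m = j))) [0..<k]"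
      by blast
    then have "2 * Y j + 2 ^ t * v j = Y j + 2 ^ t * (v j + of_bool (j = j))"
      unfolding z_def map_upt_eq_iff by blast
    then have "Y j = 2 ^ t" by (simp add: algebra_simps)
    moreover have "Y j < 2 ^ t" using Y(2) j(1) by blast
    ultimately show False by simp
  qed
  ultimately have "?A = padd {z} (sq (2 ^ t) (map ?f [0..<k]))"
    by (auto simp: padd_def)
  then show ?thesis
    using hit_padd[OF z_hit] sq_in_hit[of "2 ^ t" "map ?f [0..<k]" k] by simp
qed

subsection \<open>Functionals that vanish on hit polynomials\<close>

text \<open>The index tuples of the Cartan formula. Adding \<open>e\<close> is injective on them, so
  counting tuples counts the monomials of \<open>sq i e\<close>.\<close>

definition odd_choices :: "nat list \<Rightarrow> nat \<Rightarrow> nat list set" where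
  "odd_choices e i = {t. length t = length e \<and> sum_list t = i
     \<and> (\<forall>j<length e. odd (e ! j choose t ! j))}"

lemma finite_odd_choices: "finite (odd_choices e i)"
proof (rule finite_subset)
  show "odd_choices e i \<subseteq> {t. set t \<subseteq> {..i} \<and> length t = length e}"
    by (auto simp: odd_choices_def dest: member_le_sum_list)
qed (rule finite_lists_length_eq, simp)

lemma odd_choices_Cons:
  "odd_choices (a # e) i = (\<Union>s\<in>{s. s \<le> i \<and> odd (a choose s)}. (#) s ` odd_choices e (i - s))"
proof (intro equalityI subsetI)
  fix t assume "t \<in> odd_choices (a # e) i"
  then have t: "length t = Suc (length e)" "sum_list t = i"
    "\<forall>j<Suc (length e). odd ((a # e) ! j choose t ! j)"
    by (simp_all add: odd_choices_def)
  from t(1) obtain s r where sr: "t = s # r" by (cases t) auto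
  have "odd (a choose s)" using t(3)[rule_format, of 0] sr by simp
  moreover have "\<forall>j<length e. odd (e ! j choose r ! j)"
    using t(3)[rule_format, of "Suc _"] sr by simp
  ultimately show "t \<in> (\<Union>s\<in>{s. s \<le> i \<and> odd (a choose s)}. (#) s ` odd_choices e (i - s))"
    using t sr by (intro UN_I[of s]) (auto simp: odd_choices_def)
next
  fix t assume "t \<in> (\<Union>s\<in>{s. s \<le> i \<and> odd (a choose s)}. (#) s ` odd_choices e (i - s))"
  then obtain s r where "t = s # r" "s \<le> i" "odd (a choose s)" "r \<in> odd_choices e (i - s)"
    by auto
  then show "t \<in> odd_choices (a # e) i"
    by (simp add: odd_choices_def nth_Cons split: nat.split)
qed

text \<open>Vandermonde's identity modulo 2: each entry of \<open>e\<close> contributes a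
  convolution with its binomial coefficients, and only the odd products are counted.\<close>

lemma odd_card_odd_choices: "odd (card (odd_choices e i)) \<longleftrightarrow> odd (sum_list e choose i)"
proof (induction e arbitrary: i)
  case Nil
  have "odd_choices [] i = (if i = 0 then {[]} else {})"
    by (auto simp: odd_choices_def)
  then show ?case by (cases i) simp_all
next
  case (Cons a e)
  let ?S = "{s. s \<le> i \<and> odd (a choose s)}"
  have fin: "finite ?S"
    by (rule finite_subset[of _ "{..i}"]) auto
  have "card (odd_choices (a # e) i) = (\<Sum>s\<in>?S. card ((#) s ` odd_choices e (i - s)))"
    unfolding odd_choices_Cons
    by (rule card_UN_disjoint) (use fin finite_odd_choices in auto)
  also have "\<dots> = (\<Sum>s\<in>?S. card (odd_choices e (i - s)))"
    by (intro sum.cong refl card_image) simp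
  finally have "odd (card (odd_choices (a # e) i)) \<longleftrightarrow>
      odd (card {s \<in> ?S. odd (sum_list e choose (i - s))})"
    using fin Cons.IH by (simp add: even_sum_iff)
  also have "{s \<in> ?S. odd (sum_list e choose (i - s))} =
      {s \<in> {..i}. odd ((a choose s) * (sum_list e choose (i - s)))}"
    by auto
  also have "odd (card \<dots>) \<longleftrightarrow> odd (\<Sum>s\<le>i. (a choose s) * (sum_list e choose (i - s)))"
    by (subst even_sum_iff) simp_all
  also have "(\<Sum>s\<le>i. (a choose s) * (sum_list e choose (i - s))) = sum_list (a # e) choose i"
    by (simp add: vandermonde)
  finally show ?case .
qed

definition supp :: "mono \<Rightarrow> nat set" where
  "supp x = {j. j < length x \<and> x ! j \<noteq> 0}"

definition flagged :: "nat \<Rightarrow> nat set \<Rightarrow> nat \<Rightarrow> (nat \<Rightarrow> bool) \<Rightarrow> mono \<Rightarrow> bool" where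
  "flagged N T m R x \<longleftrightarrow> mdeg x = N \<and> supp x = T \<and> R (x ! m)"

lemma sum_list_map2_add: "length s = length t \<Longrightarrow> sum_list (map2 (+) s t) = sum_list s + (sum_list t :: nat)"
  by (induction s t rule: list_induct2) auto

lemma map2_add_left_cancel:
  "length s = length t \<Longrightarrow> length s = length r \<Longrightarrow>
    map2 (+) s t = map2 (+) s (r :: nat list) \<longleftrightarrow> t = r"
  by (auto simp: list_eq_iff_nth_eq)

text \<open>By the hypothesis on \<open>R\<close>, the flagged terms of \<open>sq i e\<close>
  correspond to all Cartan terms of the tuple obtained from \<open>e\<close> by lowering the
  \<open>m\<close>-th entry by 1. Their number has the parity of
  \<open>(deg e - 1) choose i\<close>, and \<open>(deg e - 1) + i = 2 ^ d - 1\<close>.\<close>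

lemma flagged_sq_vanish:
  assumes R: "\<And>e t. odd (e choose t) \<and> R (e + t) \<longleftrightarrow> R e \<and> odd ((e - 1) choose t)"
    and R0: "\<not> R 0" and m: "m < length e" and i: "0 < i"
  shows "\<not> par (flagged (2 ^ d) T m R) (sq i e)"
proof (cases "mdeg e + i = 2 ^ d \<and> supp e = T \<and> R (e ! m)")
  case False
  \<comment> \<open>A flagged term would force the excluded conditions on \<open>e\<close>: the
    degree grows by \<open>i\<close>, the support is kept because \<open>t \<le> e\<close>, and the
    flag is inherited from \<open>e\<close>.\<close>
  have "{x \<in> sq i e. flagged (2 ^ d) T m R x} = {}"
  proof (rule ccontr)
    assume "{x \<in> sq i e. flagged (2 ^ d) T m R x} \<noteq> {}"
    then obtain x where x: "x \<in> sq i e" "flagged (2 ^ d) T m R x" by blast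
    then obtain t where t: "x = map2 (+) e t" "length t = length e" "sum_list t = i"
      "\<forall>j<length e. odd (e ! j choose t ! j)" unfolding sq_def by auto
    have "mdeg x = mdeg e + i"
      using t by (simp add: mdeg_def sum_list_map2_add)
    moreover have "t ! j \<le> e ! j" if "j < length e" for j
      using odd_binomial_le t(4) that by blast
    then have "supp x = supp e"
      using t by (fastforce simp: supp_def)
    moreover have "R (e ! m)"
      using R[of "e ! m" "t ! m"] t m x(2) by (simp add: flagged_def)
    ultimately show False
      using False x(2) by (simp add: flagged_def)
  qed
  then show ?thesis by (simp only: par_def card.empty) simp
next
  case True
  let ?e = "e[m := e ! m - 1]"
  have "{x \<in> sq i e. flagged (2 ^ d) T m R x} = map2 (+) e ` odd_choices ?e i"
  proof (intro equalityI subsetI)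
    fix x assume "x \<in> {x \<in> sq i e. flagged (2 ^ d) T m R x}"
    then obtain t where t: "x = map2 (+) e t" "length t = length e" "sum_list t = i"
      "\<forall>j<length e. odd (e ! j choose t ! j)" "R (x ! m)"
      unfolding sq_def flagged_def by auto
    have "odd ((e ! m - 1) choose t ! m)"
      using R[of "e ! m" "t ! m"] t m by simp
    then have "t \<in> odd_choices ?e i"
      using t m by (auto simp: odd_choices_def nth_list_update)
    then show "x \<in> map2 (+) e ` odd_choices ?e i"
      using t(1) by blast
  next
    fix x assume "x \<in> map2 (+) e ` odd_choices ?e i"
    then obtain t where t: "x = map2 (+) e t" "length t = length e" "sum_list t = i"
      "\<forall>j<length e. odd (?e ! j choose t ! j)"
      unfolding odd_choices_def by auto
    have m': "odd (e ! m choose t ! m)" "R (e ! m + t ! m)"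
      using R[of "e ! m" "t ! m"] t(4)[rule_format, OF m] m True by auto
    have odd: "odd (e ! j choose t ! j)" if "j < length e" for j
      using t(4)[rule_format, OF that] m' that by (cases "j = m") auto
    have "mdeg x = mdeg e + i"
      using t by (simp add: mdeg_def sum_list_map2_add)
    moreover have "t ! j \<le> e ! j" if "j < length e" for j
      using odd_binomial_le odd that by blast
    then have "supp x = supp e"
      using t by (fastforce simp: supp_def)
    ultimately have "flagged (2 ^ d) T m R x"
      using True m' t m by (simp add: flagged_def)
    moreover have "x \<in> sq i e"
      unfolding sq_def using t odd by blast
    ultimately show "x \<in> {x \<in> sq i e. flagged (2 ^ d) T m R x}" by simp
  qed
  moreover have "inj_on (map2 (+) e) (odd_choices ?e i)"
    by (rule inj_onI) (simp add: odd_choices_def map2_add_left_cancel)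
  \<comment> \<open>So the truncated subtraction in \<open>?e\<close> really lowers the degree by
    1.\<close>
  moreover have "e ! m \<noteq> 0" using True R0 by metis
  then have "sum_list ?e + 1 = sum_list e"
    using m elem_le_sum_list[OF m] by (simp add: sum_list_update)
  then have "sum_list ?e + i = 2 ^ d - 1"
    using True unfolding mdeg_def by linarith
  then have "even (sum_list ?e choose i)"
    using i by (rule even_binomial_complementary)
  ultimately show ?thesis
    by (simp add: par_def card_image odd_card_odd_choices)
qed

definition theta :: "nat \<Rightarrow> bool" where
  "theta a \<longleftrightarrow> odd a \<and> a \<noteq> 1"

definition psi :: "nat \<Rightarrow> bool" where
  "psi a \<longleftrightarrow> a = 1"

lemma not_flag_0 [simp]: "\<not> psi 0" "\<not> theta 0"
  by (simp_all add: psi_def theta_def)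

lemma flag_psi: "odd (e choose t) \<and> psi (e + t) \<longleftrightarrow> psi e \<and> odd ((e - 1) choose t)"
  unfolding psi_def using odd_binomial_le[of "e - 1" t] by (cases t; cases e) auto

text \<open>For odd \<open>e\<close> and even \<open>t\<close> the binomial coefficients of
  \<open>e\<close> and \<open>e - 1\<close> have the same parity; odd \<open>t\<close> fail on both
  sides, by the parity of \<open>e + t\<close> and by Lucas for the even number
  \<open>e - 1\<close>. For \<open>e = 1\<close> only the exponents 1 and 2 arise, and neither is
  flagged.\<close>

lemma flag_theta:
  "odd (e choose t) \<and> theta (e + t) \<longleftrightarrow> theta e \<and> odd ((e - 1) choose t)"
proof (cases "odd e")
  case True
  then have "odd (e choose t) \<and> even t \<longleftrightarrow> odd ((e - 1) choose t)"
    using odd_binomial_div2[of e t] odd_binomial_div2[of "e - 1" t] by (auto elim!: oddE)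
  moreover have "e = 1 \<Longrightarrow> odd (e choose t) \<Longrightarrow> t \<le> 1"
    using odd_binomial_le by blast
  ultimately show ?thesis
    using True by (cases "e = 1") (auto elim!: oddE simp: theta_def)
next
  case False
  then show ?thesis
    using odd_binomial_div2[of e t] by (auto simp: theta_def)
qed

lemma hit_flagged:
  assumes "f \<in> hit k" "m < k" "R = psi \<or> R = theta"
  shows "\<not> par (flagged (2 ^ d) T m R) f"
proof (rule hit_par_vanish[OF assms(1)])
  fix i :: nat and e :: mono assume "0 < i" "length e = k"
  then show "\<not> par (flagged (2 ^ d) T m R) (sq i e)"
    using assms(2,3)
    using flagged_sq_vanish[OF flag_psi, of m e i d T] flagged_sq_vanish[OF flag_theta, of m e i d T]
    by auto
qed

subsection \<open>Pairs and words\<close>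

text \<open>The exponent of \<open>x_m\<close> in the product of the \<open>2^t\<close>-th powers of
  the letters, \<open>t\<close> counted from 0.\<close>

primrec wexp :: "nat list \<Rightarrow> nat \<Rightarrow> nat" where
  "wexp [] m = 0"
| "wexp (a # ws) m = of_bool (m = a) + 2 * wexp ws m"

text \<open>The monomial \<open>x_i x_j (x_{w_1})^2 (x_{w_2})^4 (x_{w_3})^8 \<dots>\<close> (indices from 0).\<close>

definition pmon :: "nat \<Rightarrow> nat \<Rightarrow> nat \<Rightarrow> nat list \<Rightarrow> mono" where
  "pmon k i j ws = map (\<lambda>m. of_bool (m = i) + of_bool (m = j) + 2 * wexp ws m) [0..<k]"

lemma wexp_append: "wexp (xs @ ys) m = wexp xs m + 2 ^ length xs * wexp ys m"
  by (induction xs) (auto simp: algebra_simps)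

lemma wexp_less: "wexp ws m < 2 ^ length ws"
proof (induction ws)
  case (Cons a ws)
  then show ?case by (cases "m = a") auto
qed simp

lemma wexp_eq_0_iff [simp]: "wexp ws m = 0 \<longleftrightarrow> m \<notin> set ws"
  by (induction ws) auto

lemma wexp_pos_iff [simp]: "0 < wexp ws m \<longleftrightarrow> m \<in> set ws"
  using wexp_eq_0_iff[of ws m] by linarith

lemma sum_wexp: "set ws \<subseteq> {..<k} \<Longrightarrow> (\<Sum>m<k. wexp ws m) + 1 = 2 ^ length ws"
  by (induction ws) (auto simp: sum.distrib sum_distrib_left[symmetric])

lemma pmon_append:
  "pmon k i j (xs @ ws) = map (\<lambda>m. of_bool (m = i) + of_bool (m = j) + 2 * wexp xs m
    + 2 ^ Suc (length xs) * wexp ws m) [0..<k]"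
  by (simp add: pmon_def wexp_append algebra_simps)

lemma pmon_commute: "pmon k i j ws = pmon k j i ws"
  by (simp add: pmon_def add.commute)

lemma length_pmon [simp]: "length (pmon k i j ws) = k"
  by (simp add: pmon_def)

lemma nth_pmon: "m < k \<Longrightarrow> pmon k i j ws ! m = of_bool (m = i) + of_bool (m = j) + 2 * wexp ws m"
  by (simp add: pmon_def)

section \<open>Congruence of words modulo hit polynomials\<close>

definition hcong :: "nat \<Rightarrow> poly \<Rightarrow> poly \<Rightarrow> bool" where
  "hcong k f g \<longleftrightarrow> padd f g \<in> hit k"

lemma hcong_refl [simp]: "hcong k f f"
  by (simp add: hcong_def hit_zero)

lemma hcong_sym: "hcong k f g \<Longrightarrow> hcong k g f"
  by (simp add: hcong_def padd_commute)

lemma hcong_trans [trans]: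
  assumes "hcong k f g" "hcong k g h"
  shows "hcong k f h"
proof -
  have "padd (padd f g) (padd g h) = padd f h"
    by (simp add: padd_assoc)
  then show ?thesis
    using hit_padd[of "padd f g" k "padd g h"] assms by (simp add: hcong_def)
qed

lemma hcong_padd:
  assumes "hcong k f g" "hcong k f' g'"
  shows "hcong k (padd f f') (padd g g')"
proof -
  have "padd (padd f f') (padd g g') = padd (padd f g) (padd f' g')"
    by (simp add: padd_ac)
  then show ?thesis
    using hit_padd[of "padd f g" k "padd f' g'"] assms by (simp add: hcong_def)
qed

lemma hcong_hit: "hcong k f g \<Longrightarrow> f \<in> hit k \<longleftrightarrow> g \<in> hit k"
  unfolding hcong_def by (metis hit_padd_iff padd_commute)

lemma hcong_pair: "{x, y} \<in> hit k \<Longrightarrow> hcong k {x} {y}"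
  by (cases "x = y") (auto simp: hcong_def hit_zero padd_def insert_commute)

text \<open>The pair times the prefix \<open>xs\<close> has degree
  \<open>2 + 2 (2 ^ length xs - 1)\<close>, which is exactly the power of 2 at which the remaining
  letters start; so \<open>mult_pow_Sq1_hit\<close> applies with this product as \<open>Y\<close>.
  The exponents of \<open>v\<close> are odd only at \<open>a\<close> and \<open>b\<close>, so
  \<open>Sq^1 v\<close> has just two terms.\<close>

lemma pmon_pair_hcong:
  assumes ij: "i < k" "j < k" "i \<noteq> j" and xs: "set xs \<subseteq> {..<k}"
    and ab: "a < k" "b < k" and v: "\<And>l. l < k \<Longrightarrow> odd (v l) \<longleftrightarrow> l = a \<or> l = b"
    and p: "\<And>m. v m + of_bool (m = a) = wexp p m" and q: "\<And>m. v m + of_bool (m = b) = wexp q m"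
  shows "hcong k {pmon k i j (xs @ p)} {pmon k i j (xs @ q)}"
proof (rule hcong_pair)
  let ?Y = "\<lambda>m. of_bool (m = i) + of_bool (m = j) + 2 * wexp xs m" and ?t = "Suc (length xs)"
  have "(\<Sum>m<k. ?Y m) = 2 ^ ?t"
    using ij sum_wexp[OF xs] by (simp add: sum.distrib sum_distrib_left[symmetric])
  \<comment> \<open>As \<open>i \<noteq> j\<close>, the pair adds at most 1 to an exponent, and the
    prefix at most \<open>2 ^ ?t - 2\<close>.\<close>
  moreover have "?Y m < 2 ^ ?t" for m
    using ij(3) wexp_less[of xs m] by (auto simp: of_bool_def)
  ultimately have "{map (\<lambda>m. ?Y m + 2 ^ ?t * (v m + of_bool (m = l))) [0..<k] | l. l < k \<and> odd (v l)} \<in> hit k"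
    by (intro mult_pow_Sq1_hit) auto
  also have "{map (\<lambda>m. ?Y m + 2 ^ ?t * (v m + of_bool (m = l))) [0..<k] | l. l < k \<and> odd (v l)} =
    (\<lambda>l. map (\<lambda>m. ?Y m + 2 ^ ?t * (v m + of_bool (m = l))) [0..<k]) ` {a, b}"
    using v ab by blast
  also have "\<dots> = {pmon k i j (xs @ p), pmon k i j (xs @ q)}"
    by (simp only: pmon_append p q image_insert image_empty)
  finally show "{pmon k i j (xs @ p), pmon k i j (xs @ q)} \<in> hit k" .
qed

text \<open>The two terms of \<open>Sq^1\<close> on \<open>x_a x_b\<close> times a fourth power are
  \<open>x_a x_b^2\<close> and \<open>x_a^2 x_b\<close>, the words ab and ba.\<close>

lemma pmon_swap_hcong:
  assumes "i < k" "j < k" "i \<noteq> j" "set (xs @ [a, b] @ ys) \<subseteq> {..<k}"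
  shows "hcong k {pmon k i j (xs @ a # b # ys)} {pmon k i j (xs @ b # a # ys)}"
proof (cases "a = b")
  case False
  then show ?thesis
    using assms by (intro pmon_pair_hcong[where a = b and b = a
      and v = "\<lambda>m. of_bool (m = a) + of_bool (m = b) + 4 * wexp ys m"]) auto
qed simp

text \<open>The two terms of \<open>Sq^1\<close> on \<open>x_a^3 x_b^3\<close> times an eighth power
  contain \<open>x_a^3 x_b^4\<close> and \<open>x_a^4 x_b^3\<close>, the words aab and bba. This
  moves a repetition from one letter to another.\<close>

lemma pmon_exchange_hcong:
  assumes "i < k" "j < k" "i \<noteq> j" "set (xs @ [a, b] @ ys) \<subseteq> {..<k}" "a \<noteq> b"
  shows "hcong k {pmon k i j (xs @ a # a # b # ys)} {pmon k i j (xs @ b # b # a # ys)}"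
  using assms by (intro pmon_pair_hcong[where a = b and b = a
      and v = "\<lambda>m. 3 * of_bool (m = a) + 3 * of_bool (m = b) + 8 * wexp ys m"]) auto

lemma pmon_move_front_hcong:
  assumes "i < k" "j < k" "i \<noteq> j" "set (xs @ p @ a # q) \<subseteq> {..<k}"
  shows "hcong k {pmon k i j (xs @ p @ a # q)} {pmon k i j (xs @ a # p @ q)}"
  using assms(4)
proof (induction p arbitrary: xs)
  case (Cons b p)
  have "hcong k {pmon k i j ((xs @ [b]) @ p @ a # q)} {pmon k i j ((xs @ [b]) @ a # p @ q)}"
    by (rule Cons.IH) (use Cons.prems in auto)
  also have "hcong k {pmon k i j ((xs @ [b]) @ a # p @ q)} {pmon k i j (xs @ a # (b # p) @ q)}"
    using pmon_swap_hcong[of i k j xs b a "p @ q"] assms(1-3) Cons.prems by simp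
  finally show ?case by simp
qed simp

text \<open>The leading letter \<open>a\<close> of \<open>p\<close> is moved to the front of
  \<open>q\<close>. The remaining words can then differ in their letters only by whether
  \<open>a\<close> occurs again; if so, the word without \<open>a\<close> repeats some letter, and
  \<open>double\<close> trades that repetition for another \<open>a\<close>.\<close>

lemma pmon_hcong_if_set_eq:
  assumes ij: "i < k" "j < k" "i \<noteq> j"
  shows "length p = n \<Longrightarrow> length q = n \<Longrightarrow> set p = set q \<Longrightarrow> set (xs @ p) \<subseteq> {..<k} \<Longrightarrow>
    hcong k {pmon k i j (xs @ p)} {pmon k i j (xs @ q)}"
proof (induction n arbitrary: p q xs)
  case (Suc n)
  have front: "\<exists>r. hcong k {pmon k i j (xs @ q)} {pmon k i j (xs @ a # r)} \<and> length r = n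
      \<and> insert a (set r) = set q" if q: "length q = Suc n" "a \<in> set q" "set (xs @ q) \<subseteq> {..<k}" for q a
  proof -
    obtain u v where "q = u @ a # v" using q(2) by (meson split_list)
    then show ?thesis
      using pmon_move_front_hcong[OF ij, of xs u a v] q by (intro exI[of _ "u @ v"]) auto
  qed
  \<comment> \<open>Two copies of a repeated letter b are collected behind a; swaps turn abb into
    bba, and the exchange turns this into aab.\<close>
  have double: "\<exists>r'. hcong k {pmon k i j (xs @ a # r)} {pmon k i j (xs @ a # r')}
      \<and> length r' = length r \<and> set r' = insert a (set r)"
    if r: "card (set r) < length r" "set (xs @ a # r) \<subseteq> {..<k}" "a \<notin> set r" for r a
  proof -
    obtain u v w b where d: "r = u @ [b] @ v @ [b] @ w"
      using r(1) not_distinct_decomp[of r] distinct_card[of r] by force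
    have sub: "set (xs @ a # b # b # u @ v @ w) \<subseteq> {..<k}" "a \<noteq> b"
      using d r(2,3) by auto
    have "hcong k {pmon k i j ((xs @ [a]) @ u @ b # (v @ b # w))} {pmon k i j ((xs @ [a]) @ b # u @ (v @ b # w))}"
      by (rule pmon_move_front_hcong[OF ij]) (use sub in auto)
    also have "hcong k \<dots> {pmon k i j ((xs @ [a, b]) @ b # (u @ v) @ w)}"
      using pmon_move_front_hcong[OF ij, of "xs @ [a, b]" "u @ v" b w] sub by auto
    also have "hcong k \<dots> {pmon k i j (xs @ b # [a] @ b # u @ v @ w)}"
      using pmon_swap_hcong[OF ij, of xs a b "b # u @ v @ w"] sub by auto
    also have "hcong k \<dots> {pmon k i j (xs @ b # b # a # u @ v @ w)}"
      using pmon_swap_hcong[OF ij, of "xs @ [b]" a b "u @ v @ w"] sub by auto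
    also have "hcong k \<dots> {pmon k i j (xs @ a # a # b # u @ v @ w)}"
      using pmon_exchange_hcong[OF ij, of xs b a "u @ v @ w"] sub by auto
    finally show ?thesis
      using d by (intro exI[of _ "a # b # u @ v @ w"]) auto
  qed
  obtain a p' where p: "p = a # p'"
    using Suc.prems(1) by (cases p) auto
  obtain r where r: "hcong k {pmon k i j (xs @ q)} {pmon k i j (xs @ a # r)}" "length r = n"
      "insert a (set r) = set q"
    using front[of q a] Suc.prems p by auto
  have IH: "hcong k {pmon k i j (xs @ a # u)} {pmon k i j (xs @ a # v)}"
    if "length u = n" "length v = n" "set u = set v" "set (xs @ a # u) \<subseteq> {..<k}" for u v
    using Suc.IH[of u v "xs @ [a]"] that by simp
  have wlog: "hcong k {pmon k i j (xs @ a # u)} {pmon k i j (xs @ a # v)}"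
    if uv: "length u = n" "length v = n" "set u = insert a (set v)" "a \<notin> set v"
      "set (xs @ a # u) \<subseteq> {..<k}" for u v
  proof -
    \<comment> \<open>Pigeonhole: \<open>u\<close> has the same length as \<open>v\<close> but one
      letter more.\<close>
    have "card (set v) < length v"
      using card_length[of u] uv by simp
    then obtain v' where v': "hcong k {pmon k i j (xs @ a # v)} {pmon k i j (xs @ a # v')}"
        "length v' = length v" "set v' = insert a (set v)"
      using double[of v a] uv by auto
    have "hcong k {pmon k i j (xs @ a # u)} {pmon k i j (xs @ a # v')}"
      by (rule IH) (use uv v' in auto)
    from hcong_trans[OF this hcong_sym[OF v'(1)]] show ?thesis .
  qed
  have sub: "length p' = n" "set (xs @ a # p') \<subseteq> {..<k}" "set (xs @ a # r) \<subseteq> {..<k}"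
      "insert a (set p') = insert a (set r)"
    using Suc.prems r p by auto
  consider "a \<in> set p'" "a \<in> set r" | "a \<notin> set p'" "a \<notin> set r"
    | "a \<in> set p'" "a \<notin> set r" | "a \<notin> set p'" "a \<in> set r" by fast
  then consider "set p' = set r" | "set p' = insert a (set r)" "a \<notin> set r"
    | "set r = insert a (set p')" "a \<notin> set p'"
    by cases (use sub(4) in \<open>auto simp: insert_absorb insert_ident\<close>)
  then have "hcong k {pmon k i j (xs @ a # p')} {pmon k i j (xs @ a # r)}"
  proof cases
    case 1
    show ?thesis by (rule IH[OF sub(1) r(2) 1 sub(2)])
  next
    case 2
    show ?thesis by (rule wlog[OF sub(1) r(2) 2 sub(2)])
  next
    case 3
    show ?thesis by (rule hcong_sym[OF wlog[OF r(2) sub(1) 3 sub(3)]])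
  qed
  from hcong_trans[OF this hcong_sym[OF r(1)]] show ?case
    unfolding p .
qed simp

text \<open>\<open>Sq^1\<close> raises one of three odd exponents, and the variable raised becomes
  the leading letter. The three terms differ in which exponents are odd, so none cancel.\<close>

lemma pmon_triple_hit:
  assumes "i < k" "j < k" "l < k" "i \<noteq> j" "i \<noteq> l" "j \<noteq> l"
  shows "padd {pmon k i j (l # ws)} (padd {pmon k i l (j # ws)} {pmon k j l (i # ws)}) \<in> hit k"
proof -
  let ?f = "\<lambda>m. of_bool (m = i) + of_bool (m = j) + of_bool (m = l) + 4 * wexp ws m"
  let ?x = "pmon k i j (l # ws)" and ?y = "pmon k i l (j # ws)" and ?z = "pmon k j l (i # ws)"
  have "sq 1 (map ?f [0..<k]) = (\<lambda>n. map (\<lambda>m. ?f m + of_bool (m = n)) [0..<k]) ` {i, j, l}"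
    unfolding sq_1_map using assms by auto
  also have "\<dots> = {?x, ?y, ?z}"
    by (auto simp: pmon_def)
  finally have "{?x, ?y, ?z} \<in> hit k"
    using sq_in_hit[of 1 "map ?f [0..<k]" k] by simp
  moreover have "odd (?x ! i)" "odd (?y ! i)" "even (?z ! i)" "odd (?x ! j)" "even (?y ! j)"
    using assms by (simp_all add: nth_pmon)
  then have "?x \<noteq> ?y" "?x \<noteq> ?z" "?y \<noteq> ?z"
    by metis+
  then have "padd {?x} (padd {?y} {?z}) = {?x, ?y, ?z}"
    by (auto simp: padd_def)
  ultimately show ?thesis by simp
qed

section \<open>Classes given by a pair and a set of letters\<close>

lemma finite_ex_word:
  assumes "finite S" "S \<noteq> {}" "card S \<le> n"
  shows "\<exists>ws. length ws = n \<and> set ws = S"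
proof -
  obtain xs where xs: "set xs = S" "distinct xs"
    using assms(1) finite_distinct_list by blast
  obtain a where "a \<in> S" using assms(2) by blast
  moreover have "length xs \<le> n"
    using xs assms(3) distinct_card by metis
  ultimately show ?thesis
    using xs by (intro exI[of _ "xs @ replicate (n - length xs) a"]) (auto simp: set_replicate_conv_if)
qed

text \<open>An arbitrary representative: by \<open>pmon_hcong_if_set_eq\<close> another choice
  changes the monomial of a given pair only by a hit polynomial.\<close>

definition word :: "nat \<Rightarrow> nat set \<Rightarrow> nat list" where
  "word n S = (SOME ws. length ws = n \<and> set ws = S)"

lemma word:
  assumes "finite S" "S \<noteq> {}" "card S \<le> n"
  shows "length (word n S) = n" "set (word n S) = S"
  using someI_ex[OF finite_ex_word[OF assms]] by (simp_all add: word_def)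

text \<open>The class of the monomials \<open>x_i x_j w\<close> with \<open>w\<close> a word of length \<open>n\<close> in the set of letters \<open>S\<close>;
  it is meaningful only for nonempty \<open>S\<close> with at most \<open>n\<close> elements.\<close>

definition cls :: "nat \<Rightarrow> nat \<Rightarrow> nat \<Rightarrow> nat \<Rightarrow> nat set \<Rightarrow> mono" where
  "cls k n i j S = pmon k i j (word n S)"

lemma cls_commute: "cls k n i j S = cls k n j i S"
  by (simp add: cls_def pmon_commute)

lemma pmon_hcong_cls:
  assumes "i < k" "j < k" "i \<noteq> j" "length ws = n" "set ws \<subseteq> {..<k}" "0 < n"
  shows "hcong k {pmon k i j ws} {cls k n i j (set ws)}"
proof -
  have "set ws \<noteq> {}" using assms by auto
  then show ?thesis
    using pmon_hcong_if_set_eq[OF assms(1-3), of ws n "word n (set ws)" "[]"] assms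
      word[of "set ws" n] card_length[of ws]
    by (simp add: cls_def)
qed

text \<open>The strict bound on \<open>card S\<close> leaves one place of the word for the leading
  letter, while the other \<open>n - 1\<close> places use up exactly the letters of
  \<open>S\<close>.\<close>

lemma cls_triple_hit_nonempty:
  assumes ijl: "i < k" "j < k" "l < k" "i \<noteq> j" "i \<noteq> l" "j \<noteq> l"
    and S: "S \<subseteq> {..<k}" "S \<noteq> {}" "card S < n"
  shows "padd {cls k n i j (insert l S)} (padd {cls k n i l (insert j S)} {cls k n j l (insert i S)}) \<in> hit k"
proof -
  have "finite S" using S(1) finite_subset by blast
  moreover have "card S \<le> n - 1" using S(3) by simp
  ultimately obtain ws where ws: "length ws = n - 1" "set ws = S"
    using finite_ex_word S(2) by blast
  have n: "n = Suc (n - 1)" using S by simp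
  have "hcong k {pmon k i j (l # ws)} {cls k n i j (insert l S)}"
    "hcong k {pmon k i l (j # ws)} {cls k n i l (insert j S)}"
    "hcong k {pmon k j l (i # ws)} {cls k n j l (insert i S)}"
    using ijl ws S n pmon_hcong_cls[of i k j "l # ws" n] pmon_hcong_cls[of i k l "j # ws" n]
      pmon_hcong_cls[of j k l "i # ws" n] by simp_all
  then have "hcong k (padd {pmon k i j (l # ws)} (padd {pmon k i l (j # ws)} {pmon k j l (i # ws)}))
    (padd {cls k n i j (insert l S)} (padd {cls k n i l (insert j S)} {cls k n j l (insert i S)}))"
    by (intro hcong_padd)
  from hcong_hit[OF this] show ?thesis
    using pmon_triple_hit[OF ijl] by blast
qed

text \<open>For \<open>S = {}\<close> there is no square to apply; the relation is the sum of the relations for the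
  seven nonempty subsets of \<open>{i, j, l}\<close>.\<close>

lemma cls_triple_hit:
  assumes ijl: "i < k" "j < k" "l < k" "i \<noteq> j" "i \<noteq> l" "j \<noteq> l"
    and S: "S \<subseteq> {..<k}" "card S < n" and n: "4 \<le> n"
  shows "padd {cls k n i j (insert l S)} (padd {cls k n i l (insert j S)} {cls k n j l (insert i S)}) \<in> hit k"
proof (cases "S = {}")
  case False
  then show ?thesis using cls_triple_hit_nonempty[OF ijl S(1) _ S(2)] by blast
next
  case True
  let ?r = "\<lambda>S. padd {cls k n i j (insert l S)} (padd {cls k n i l (insert j S)} {cls k n j l (insert i S)})"
  have r: "?r S' \<in> hit k" if "S' \<subseteq> {i, j, l}" "S' \<noteq> {}" for S'
  proof (rule cls_triple_hit_nonempty[OF ijl _ that(2)])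
    show "S' \<subseteq> {..<k}" using that ijl by auto
    have "card S' \<le> card {i, j, l}" using that by (intro card_mono) auto
    also have "\<dots> < n" using n ijl by simp
    finally show "card S' < n" .
  qed
  \<comment> \<open>The class of the pair ij with letters R, where l is in R, comes from the subsets
    R and R - {l}, and so cancels unless R = {l}, whose second source is the empty set; likewise for
    the other pairs. The subset {i, j, l} is what requires \<open>4 \<le> n\<close>.\<close>
  have "padd (?r {i}) (padd (?r {j}) (padd (?r {l}) (padd (?r {i, j}) (padd (?r {i, l})
      (padd (?r {j, l}) (?r {i, j, l})))))) \<in> hit k"
    by (rule hit_padd[OF r hit_padd[OF r hit_padd[OF r hit_padd[OF r hit_padd[OF r hit_padd[OF r r]]]]]]) auto
  also have "padd (?r {i}) (padd (?r {j}) (padd (?r {l}) (padd (?r {i, j}) (padd (?r {i, l})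
      (padd (?r {j, l}) (?r {i, j, l})))))) = ?r {}"
    by (simp add: insert_commute padd_ac)
  finally show ?thesis
    using True by simp
qed

text \<open>A set \<open>C\<close> of monomials is itself a polynomial, the sum of its members, so
  no coefficients appear.\<close>

definition spanned :: "nat \<Rightarrow> mono set \<Rightarrow> poly \<Rightarrow> bool" where
  "spanned k B f \<longleftrightarrow> (\<exists>C\<subseteq>B. hcong k f C)"

lemma spanned_mem: "x \<in> B \<Longrightarrow> spanned k B {x}"
  unfolding spanned_def by (intro exI[of _ "{x}"]) simp

lemma spanned_hcong: "hcong k f g \<Longrightarrow> spanned k B g \<Longrightarrow> spanned k B f"
  unfolding spanned_def using hcong_trans by blast

lemma spanned_padd: "spanned k B f \<Longrightarrow> spanned k B g \<Longrightarrow> spanned k B (padd f g)"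
  unfolding spanned_def by (meson hcong_padd padd_subset)

lemma spanned_cls_triple:
  assumes "i < k" "j < k" "l < k" "i \<noteq> j" "i \<noteq> l" "j \<noteq> l" "S \<subseteq> {..<k}" "card S < n" "4 \<le> n"
    and "spanned k B {cls k n i l (insert j S)}" "spanned k B {cls k n j l (insert i S)}"
  shows "spanned k B {cls k n i j (insert l S)}"
proof (rule spanned_hcong)
  show "hcong k {cls k n i j (insert l S)} (padd {cls k n i l (insert j S)} {cls k n j l (insert i S)})"
    using cls_triple_hit[OF assms(1-9)] by (simp add: hcong_def)
qed (intro spanned_padd assms)

subsection \<open>Weight vectors\<close>

abbreviation halve :: "mono \<Rightarrow> mono" where
  "halve x \<equiv> map (\<lambda>a. a div 2) x"

lemma wt_eq_card: "wt x t = card {j. j < length x \<and> odd (x ! j div 2 ^ t)}"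
proof -
  have "wt x t = (\<Sum>j<length x. of_bool (odd (x ! j div 2 ^ t)))"
    unfolding wt_def by (intro sum.cong) (auto simp: mod_2_eq_odd)
  also have "\<dots> = card {j. j < length x \<and> odd (x ! j div 2 ^ t)}"
    by (simp add: Int_def)
  finally show ?thesis .
qed

lemma wt_0: "wt x 0 = card {j. j < length x \<and> odd (x ! j)}"
  using wt_eq_card[of x 0] by simp

lemma wt_Suc: "wt x (Suc i) = wt (halve x) i"
  by (simp add: wt_def div_mult2_eq)

lemma mdeg_halve: "mdeg x = wt x 0 + 2 * mdeg (halve x)"
proof -
  have "mdeg x = (\<Sum>j<length x. x ! j mod 2 + 2 * (x ! j div 2))"
    by (simp add: mdeg_def sum_list_sum_nth atLeast0LessThan)
  also have "\<dots> = wt x 0 + 2 * mdeg (halve x)"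
    unfolding sum.distrib
    by (simp add: wt_def mdeg_def sum_list_sum_nth atLeast0LessThan sum_distrib_left)
  finally show ?thesis .
qed

lemma mdeg_eq_0_if_wt_eq_0: "(\<And>i. wt x i = 0) \<Longrightarrow> mdeg x = 0"
proof (induction "mdeg x" arbitrary: x rule: less_induct)
  case less
  show ?case
  proof (rule ccontr)
    assume "mdeg x \<noteq> 0"
    moreover have "mdeg x = 2 * mdeg (halve x)"
      using mdeg_halve[of x] less.prems by simp
    moreover have "wt (halve x) i = 0" for i
      using less.prems wt_Suc by metis
    ultimately show False
      using less.hyps[of "halve x"] by simp
  qed
qed

text \<open>Weight 1 at a place means that exactly one exponent has binary digit 1 there; this
  variable is the letter.\<close>

lemma ex_word_if_wt:
  "length x = k \<Longrightarrow> (\<And>i. wt x i = of_bool (i < n)) \<Longrightarrow>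
    \<exists>ws. length ws = n \<and> set ws \<subseteq> {..<k} \<and> (\<forall>m<k. x ! m = wexp ws m)"
proof (induction n arbitrary: x)
  case 0
  then have "mdeg x = 0" using mdeg_eq_0_if_wt_eq_0 by simp
  then have "\<forall>m<k. x ! m = 0"
    using 0(1) by (simp add: mdeg_def)
  then show ?case by (intro exI[of _ "[]"]) simp
next
  case (Suc n)
  have "wt (halve x) i = of_bool (i < n)" for i
    using Suc.prems(2)[of "Suc i"] by (simp add: wt_Suc)
  then obtain ws where ws: "length ws = n" "set ws \<subseteq> {..<k}" "\<forall>m<k. halve x ! m = wexp ws m"
    using Suc.IH[of "halve x"] Suc.prems(1) by auto
  have "card {j. j < k \<and> odd (x ! j)} = 1"
    using Suc.prems wt_0[of x] by simp
  then obtain a where a: "{j. j < k \<and> odd (x ! j)} = {a}"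
    by (auto simp: card_1_singleton_iff)
  have "x ! m = wexp (a # ws) m" if "m < k" for m
  proof -
    have "odd (x ! m) \<longleftrightarrow> m = a" using a that by blast
    moreover have "x ! m div 2 = wexp ws m" using ws(3) that Suc.prems(1) by simp
    moreover have "x ! m = x ! m mod 2 + 2 * (x ! m div 2)" by simp
    ultimately show ?thesis by (simp add: mod_2_eq_odd)
  qed
  then show ?case
    using ws a by (intro exI[of _ "a # ws"]) auto
qed

lemma wt_word: "set ws \<subseteq> {..<k} \<Longrightarrow> wt (map (wexp ws) [0..<k]) i = of_bool (i < length ws)"
proof (induction ws arbitrary: i)
  case Nil
  then show ?case by (simp add: wt_def)
next
  case (Cons a ws)
  show ?case
  proof (cases i)
    case 0
    let ?x = "map (wexp (a # ws)) [0..<k]"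
    have "{j. j < length ?x \<and> odd (?x ! j)} = {a}"
      using Cons.prems by auto
    then show ?thesis
      unfolding 0 wt_0 by simp
  next
    case (Suc i')
    have h: "halve (map (wexp (a # ws)) [0..<k]) = map (wexp ws) [0..<k]"
      by auto
    show ?thesis
      unfolding Suc wt_Suc h using Cons by simp
  qed
qed

definition wmons :: "nat \<Rightarrow> nat \<Rightarrow> mono set" where
  "wmons k d = {x. length x = k \<and> wt x = omega_d d}"

lemma pmon_in_wmons:
  assumes "i < k" "j < k" "i \<noteq> j" "set ws \<subseteq> {..<k}" "length ws = n"
  shows "pmon k i j ws \<in> wmons k (Suc n)"
proof -
  have "wt (pmon k i j ws) l = omega_d (Suc n) l" for l
  proof (cases l)
    case 0
    have "{m. m < k \<and> odd (pmon k i j ws ! m)} = {i, j}"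
      using assms by (auto simp: nth_pmon)
    then show ?thesis
      using 0 assms(3) by (simp add: wt_0 omega_d_def)
  next
    case (Suc l')
    have "halve (pmon k i j ws) = map (wexp ws) [0..<k]"
      using assms(3) by (auto simp: pmon_def)
    then show ?thesis
      using Suc wt_word[OF assms(4)] assms(5) by (simp add: wt_Suc omega_d_def)
  qed
  then show ?thesis by (auto simp: wmons_def)
qed

lemma wmons_ex_pmon:
  assumes "x \<in> wmons k (Suc n)"
  obtains i j ws where "i < k" "j < k" "i \<noteq> j" "length ws = n" "set ws \<subseteq> {..<k}" "x = pmon k i j ws"
proof -
  have len: "length x = k" and w: "wt x = omega_d (Suc n)"
    using assms by (auto simp: wmons_def)
  have "wt (halve x) i = of_bool (i < n)" for i
    by (simp add: w omega_d_def flip: wt_Suc)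
  then obtain ws where ws: "length ws = n" "set ws \<subseteq> {..<k}" "\<forall>m<k. halve x ! m = wexp ws m"
    using ex_word_if_wt[of "halve x" k n] len by auto
  have "card {j. j < k \<and> odd (x ! j)} = 2"
    using wt_0[of x] w len by (simp add: omega_d_def)
  then obtain i j where ij: "{j. j < k \<and> odd (x ! j)} = {i, j}" "i \<noteq> j"
    by (auto simp: card_2_iff)
  have "x ! m = pmon k i j ws ! m" if "m < k" for m
  proof -
    have "odd (x ! m) \<longleftrightarrow> m = i \<or> m = j" using ij that by blast
    moreover have "x ! m div 2 = wexp ws m" using ws(3) that len by simp
    moreover have "x ! m = x ! m mod 2 + 2 * (x ! m div 2)" by simp
    ultimately show ?thesis using ij(2) that by (auto simp: mod_2_eq_odd nth_pmon)
  qed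
  then have "x = pmon k i j ws"
    using len by (intro nth_equalityI) auto
  moreover have "i < k" "j < k" using ij by blast+
  ultimately show ?thesis using that ws ij(2) by blast
qed

lemma mdeg_pmon:
  assumes "i < k" "j < k" "set ws \<subseteq> {..<k}"
  shows "mdeg (pmon k i j ws) = 2 ^ Suc (length ws)"
proof -
  have "mdeg (pmon k i j ws) = (\<Sum>m<k. of_bool (m = i) + of_bool (m = j) + 2 * wexp ws m)"
    by (simp add: mdeg_def pmon_def sum_list_sum_nth atLeast0LessThan)
  also have "\<dots> = 2 * ((\<Sum>m<k. wexp ws m) + 1)"
    using assms by (simp add: sum.distrib sum_distrib_left)
  finally show ?thesis using sum_wexp[OF assms(3)] by simp
qed

lemma mdeg_wmons: "x \<in> wmons k (Suc n) \<Longrightarrow> mdeg x = 2 ^ Suc n"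
  by (metis wmons_ex_pmon mdeg_pmon)

lemma supp_pmon:
  assumes "i < k" "j < k" "set ws \<subseteq> {..<k}"
  shows "supp (pmon k i j ws) = {i, j} \<union> set ws"
  using assms by (auto simp: supp_def nth_pmon subset_iff)

lemma flags_pmon:
  assumes "m < k" "i \<noteq> j"
  shows "psi (pmon k i j ws ! m) \<longleftrightarrow> m \<in> {i, j} \<and> m \<notin> set ws"
    and "theta (pmon k i j ws ! m) \<longleftrightarrow> m \<in> {i, j} \<and> m \<in> set ws"
  using assms by (auto simp: nth_pmon psi_def theta_def)

lemma wdeg_omega_d: "wdeg (omega_d (Suc n)) = 2 ^ Suc n"
proof -
  have "{i. omega_d (Suc n) i \<noteq> 0} = {..n}"
    by (auto simp: omega_d_def)
  moreover have "Max ({0} \<union> {..n}) = n"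
    by (intro Max_eqI) auto
  moreover have "(\<Sum>i<Suc n. 2 ^ i * omega_d (Suc n) i) = 2 + (\<Sum>i<n. 2 ^ Suc i)"
    unfolding sum.lessThan_Suc_shift by (simp add: omega_d_def)
  moreover have "2 + (\<Sum>i<n. 2 ^ Suc i) = (2 ^ Suc n :: nat)"
    by (induction n) auto
  ultimately show ?thesis
    unfolding wdeg_def by simp
qed

text \<open>The places below \<open>m\<close> contribute 1 + 2 + ... + \<open>2 ^ (m - 1)\<close>,
  place \<open>m\<close> nothing, and all later places multiples of
  \<open>2 ^ Suc m\<close>.\<close>

lemma mdeg_mod_if_wt_ones:
  "(\<And>i. i < m \<Longrightarrow> wt x i = 1) \<Longrightarrow> wt x m = 0 \<Longrightarrow> mdeg x mod 2 ^ Suc m = 2 ^ m - 1"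
proof (induction m arbitrary: x)
  case 0
  then show ?case by (simp add: mdeg_halve[of x])
next
  case (Suc m)
  have "mdeg (halve x) mod 2 ^ Suc m = 2 ^ m - 1"
    using Suc.prems by (intro Suc.IH) (simp_all add: wt_Suc[symmetric])
  moreover have "mdeg x = 1 + 2 * mdeg (halve x)"
    using Suc.prems mdeg_halve[of x] by simp
  moreover have "(1 + 2 * N) mod 2 ^ Suc (Suc m) = 1 + 2 * (N mod 2 ^ Suc m)" for N :: nat
    using mod_mult2_eq[of "1 + 2 * N" 2 "2 ^ Suc m"] by simp
  ultimately have "mdeg x mod 2 ^ Suc (Suc m) = 1 + 2 * (2 ^ m - 1)"
    by simp
  also have "\<dots> = 2 ^ Suc m - 1"
  proof -
    have "(1 :: nat) \<le> 2 ^ m" by simp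
    then show ?thesis unfolding power_Suc by linarith
  qed
  finally show ?case .
qed

text \<open>If the weight began with 2, its earliest deviation would be a 0 in place of a 1, and
  \<open>halve x\<close>, of degree \<open>2 ^ n - 1\<close>, would have a degree with a binary
  digit 0 at that place, which it has not. So the leading weight is below 2, and even like the
  degree, hence 0.\<close>

lemma even_if_wt_less_omega_d:
  assumes "mdeg x = 2 ^ Suc n" "lex_less (wt x) (omega_d (Suc n))" "j < length x"
  shows "even (x ! j)"
proof -
  obtain m where m: "wt x m < omega_d (Suc n) m" "\<forall>i<m. wt x i = omega_d (Suc n) i"
    using assms(2) by (auto simp: lex_less_def)
  have "m = 0"
  proof (rule ccontr)
    assume "m \<noteq> 0"
    then obtain m' where m': "m = Suc m'" using not0_implies_Suc by blast
    have "m' < n" and 0: "wt (halve x) m' = 0"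
      using m(1) m' by (auto simp: omega_d_def wt_Suc split: if_splits)
    have "mdeg (halve x) mod 2 ^ Suc m' = 2 ^ m' - 1"
    proof (rule mdeg_mod_if_wt_ones[OF _ 0])
      fix i assume "i < m'"
      then show "wt (halve x) i = 1"
        using m(2) m' \<open>m' < n\<close> by (auto simp: wt_Suc[symmetric] omega_d_def)
    qed
    moreover have "wt x 0 = 2" using m(2) m' by (simp add: omega_d_def)
    then have "mdeg (halve x) + 1 = 2 ^ n"
      using mdeg_halve[of x] assms(1) by simp
    then have "(mdeg (halve x) + 1) mod 2 ^ Suc m' = 0"
      using \<open>m' < n\<close> by (simp add: le_imp_power_dvd Suc_leI del: power_Suc)
    ultimately have "(2 ^ m' - 1 + 1) mod 2 ^ Suc m' = (0 :: nat)"
      by (metis mod_add_left_eq)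
    then show False by simp
  qed
  then have "wt x 0 < 2" using m(1) by (simp add: omega_d_def)
  moreover have "even (wt x 0)"
    using mdeg_halve[of x] assms(1) by (metis dvd_add_left_iff dvd_triv_left power_Suc)
  ultimately have "wt x 0 = 0" by presburger
  then have "{j. j < length x \<and> odd (x ! j)} = {}"
    unfolding wt_0 by simp
  then show ?thesis using assms(3) by blast
qed

lemma hit_if_all_even:
  assumes "length x = k" "mdeg x \<noteq> 0" "\<And>j. j < k \<Longrightarrow> even (x ! j)"
  shows "{x} \<in> hit k"
proof -
  have x: "x = map (\<lambda>m. 2 * (x ! m div 2)) [0..<k]"
    using assms by (intro nth_equalityI) auto
  have "(\<Sum>m<k. x ! m div 2) \<noteq> 0"
  proof
    assume "(\<Sum>m<k. x ! m div 2) = 0"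
    then have "x ! m div 2 = 0" if "m < k" for m
      using that by simp
    then have "\<forall>m<k. x ! m = 0"
      using assms(3) by (metis dvd_mult_div_cancel mult_0_right)
    then show False
      using assms(1,2) by (auto simp: mdeg_def in_set_conv_nth)
  qed
  then have "0 < (\<Sum>m<k. x ! m div 2)" by (rule neq0_conv[THEN iffD1])
  from all_even_hit[OF this] show ?thesis
    unfolding x[symmetric] .
qed

subsection \<open>Bases of the quotient\<close>

text \<open>Here \<open>n\<close> is \<open>d - 1\<close>, the length of the words; the bound is the
  one demanded by the triangles with \<open>S\<close> empty.\<close>

locale cls_context =
  fixes k n :: nat
  assumes n: "4 \<le> n"
begin

lemma cls_props:
  assumes "i < k" "j < k" "i \<noteq> j" "S \<subseteq> {..<k}" "S \<noteq> {}" "card S \<le> n"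
  shows "cls k n i j S \<in> wmons k (Suc n)" "supp (cls k n i j S) = {i, j} \<union> S"
    "m < k \<Longrightarrow> psi (cls k n i j S ! m) \<longleftrightarrow> m \<in> {i, j} \<and> m \<notin> S"
    "m < k \<Longrightarrow> theta (cls k n i j S ! m) \<longleftrightarrow> m \<in> {i, j} \<and> m \<in> S"
proof -
  have "finite S" using assms(4) finite_subset by blast
  note w = word[OF this assms(5,6)]
  show "cls k n i j S \<in> wmons k (Suc n)" "supp (cls k n i j S) = {i, j} \<union> S"
    "m < k \<Longrightarrow> psi (cls k n i j S ! m) \<longleftrightarrow> m \<in> {i, j} \<and> m \<notin> S"
    "m < k \<Longrightarrow> theta (cls k n i j S ! m) \<longleftrightarrow> m \<in> {i, j} \<and> m \<in> S"
    unfolding cls_def using assms w pmon_in_wmons supp_pmon flags_pmon by simp_all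
qed

text \<open>Fix two variables \<open>a\<close>, \<open>s\<close> of the support \<open>T\<close>. In terms of the two odd exponents (flagged \<open>psi\<close>
  if equal to 1, \<open>theta\<close> otherwise) a basis for support \<open>T\<close> consists of \<open>a psi, m psi\<close> and
  \<open>a psi, m theta\<close> for \<open>m \<noteq> a\<close>, and \<open>a theta, s psi\<close>.\<close>

lemma spanned_support:
  assumes T: "T \<subseteq> {..<k}" "3 \<le> card T" and as: "a \<in> T" "s \<in> T" "a \<noteq> s"
    and B: "\<And>m. m \<in> T - {a} \<Longrightarrow> cls k n a m (T - {a, m}) \<in> B"
      "\<And>m. m \<in> T - {a} \<Longrightarrow> cls k n a m (T - {a}) \<in> B" "cls k n a s (T - {s}) \<in> B"
    and ij: "i \<in> T" "j \<in> T" "i \<noteq> j" and S: "T - {i, j} \<subseteq> S" "S \<subseteq> T" "card S \<le> n"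
  shows "spanned k B {cls k n i j S}"
proof -
  have fin: "finite T" using T(1) finite_subset by blast
  have lt: "x < k" if "x \<in> T" for x using T(1) that by blast
  have triple: "spanned k B {cls k n i j S}"
    if "i \<in> T" "j \<in> T" "i \<noteq> j" "S \<subseteq> T" "card S \<le> n" "l \<in> S" "l \<noteq> i" "l \<noteq> j"
      "spanned k B {cls k n i l (insert j (S - {l}))}" "spanned k B {cls k n j l (insert i (S - {l}))}"
    for i j l S
  proof -
    have "card (S - {l}) < card S"
      by (rule card_Diff1_less[OF finite_subset[OF that(4) fin] that(6)])
    then have c: "card (S - {l}) < n" using that(5) by simp
    have l: "S - {l} \<subseteq> {..<k}" "l \<in> T" using that(4,6) T(1) by auto
    have "spanned k B {cls k n i j (insert l (S - {l}))}"
      by (rule spanned_cls_triple[OF lt[OF that(1)] lt[OF that(2)] lt[OF l(2)] that(3)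
            that(7)[symmetric] that(8)[symmetric] l(1) c n that(9,10)])
    then show ?thesis using that(6) by (simp add: insert_absorb)
  qed
  have base: "spanned k B {cls k n i a S}"
    if "i \<in> T" "i \<noteq> a" "T - {i, a} \<subseteq> S" "S \<subseteq> T" "a \<notin> S" for i S
  proof -
    have "S = T - {a, i} \<or> S = T - {a}" using that by blast
    then have "cls k n a i S \<in> B" using B(1,2) that by auto
    then show ?thesis using spanned_mem cls_commute by metis
  qed
  \<comment> \<open>If neither odd variable is \<open>a\<close>, then \<open>a\<close> is a letter,
    and the triangle through \<open>psi\<close> at \<open>a\<close> has two edges of the star as its
    other sides.\<close>
  have generic: "spanned k B {cls k n i j S}"
    if "i \<in> T" "j \<in> T" "i \<noteq> j" "T - {i, j} \<subseteq> S" "S \<subseteq> T" "card S \<le> n" "i \<noteq> a" "j \<noteq> a" for i j S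
    by (rule triple[of i j S a]; (rule base)?) (use that as(1) in auto)
  \<comment> \<open>With \<open>theta\<close> at \<open>a\<close>, the triangle through
    \<open>s\<close> consists of this edge, the additional tree edge and an edge avoiding
    \<open>a\<close>.\<close>
  have first: "spanned k B {cls k n a j S}"
    if "j \<in> T" "j \<noteq> a" "j \<noteq> s" "T - {a, j} \<subseteq> S" "S \<subseteq> T" "card S \<le> n" for j S
  proof (cases "a \<in> S")
    case True
    have "insert j (S - {s}) = T - {s}" using that True as by blast
    then have "spanned k B {cls k n a s (insert j (S - {s}))}"
      using B(3) spanned_mem by metis
    moreover have "card (insert a (S - {s})) \<le> n"
    proof -
      have "insert a (S - {s}) = S - {s}" using True as by blast
      then show ?thesis using that(5,6) fin by (metis card_Diff1_le finite_subset le_trans)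
    qed
    then have "spanned k B {cls k n j s (insert a (S - {s}))}"
      using that as True by (intro generic) auto
    ultimately show ?thesis
      using that as by (intro triple[of a j S s, OF as(1)]) auto
  next
    case False
    then show ?thesis
      using base[of j S] that cls_commute by (metis insert_commute)
  qed
  have second: "spanned k B {cls k n a s S}" if "T - {a, s} \<subseteq> S" "S \<subseteq> T" "card S \<le> n" for S
  proof (cases "a \<in> S \<and> s \<in> S")
    case True
    then have "S = T" using that by blast
    \<comment> \<open>Both \<open>a\<close> and \<open>s\<close> have flag \<open>theta\<close>. A
      third variable, available as \<open>3 \<le> card T\<close>, is the remaining corner of a
      triangle whose other two sides are already treated.\<close>
    have "card (T - {a, s}) \<noteq> 0" using T(2) as fin by (simp add: card_Diff_subset)
    then have "T - {a, s} \<noteq> {}" by (metis card.empty)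
    then obtain l where l: "l \<in> T" "l \<noteq> a" "l \<noteq> s" by blast
    have c: "card (T - {l}) \<le> n"
      using that(3) \<open>S = T\<close> card_Diff1_le[of T l] by simp
    have e: "insert a (T - {l}) = T - {l}" "insert s (T - {l}) = T - {l}"
      using l as by auto
    have "spanned k B {cls k n a l (insert s (T - {l}))}"
      unfolding e using l c by (intro first) auto
    moreover have "spanned k B {cls k n s l (insert a (T - {l}))}"
      unfolding e using l c as by (intro generic) auto
    ultimately show ?thesis
      unfolding \<open>S = T\<close> using l as that \<open>S = T\<close> by (intro triple[of a s T l, OF as]) auto
  next
    case False
    have "S = T - {s} \<or> a \<notin> S" using False that as by blast
    then consider "S = T - {s}" | "a \<notin> S" by blast
    then show ?thesis
    proof cases
      case 1
      then show ?thesis using B(3) spanned_mem by simp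
    next
      case 2
      then show ?thesis
        using base[of s S] that as cls_commute by (metis insert_commute)
    qed
  qed
  consider "i \<noteq> a" "j \<noteq> a" | "i = a" "j \<noteq> s" | "i = a" "j = s" | "j = a" "i \<noteq> s" | "j = a" "i = s"
    by blast
  then show ?thesis
  proof cases
    case 1
    then show ?thesis using generic ij S by blast
  next
    case 2
    then show ?thesis using first[of j S] ij S by auto
  next
    case 3
    then show ?thesis using second[of S] S by simp
  next
    case 4
    then have "spanned k B {cls k n a i S}"
      using ij S by (intro first) auto
    then show ?thesis using 4 cls_commute by metis
  next
    case 5
    then have "spanned k B {cls k n a s S}"
      using S by (intro second) auto
    then show ?thesis using 5 cls_commute by metis
  qed
qed

text \<open>A flag functional that is nonzero on \<open>C\<close>, the certificate that
  \<open>C\<close> is not hit.\<close>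

definition separated :: "nat set \<Rightarrow> mono set \<Rightarrow> bool" where
  "separated T C \<longleftrightarrow> (\<exists>m<k. \<exists>R. (R = psi \<or> R = theta) \<and> par (flagged (2 ^ Suc n) T m R) C)"

lemma separatedI:
  assumes "C \<subseteq> wmons k (Suc n)" "\<And>x. x \<in> C \<Longrightarrow> supp x = T" "y \<in> C" "m < k" "R = psi \<or> R = theta"
    "R (y ! m)" "\<And>x. x \<in> C \<Longrightarrow> R (x ! m) \<Longrightarrow> x = y"
  shows "separated T C"
proof -
  have *: "flagged (2 ^ Suc n) T m R x \<longleftrightarrow> R (x ! m)" if "x \<in> C" for x
  proof -
    have "x \<in> wmons k (Suc n)" "supp x = T" using assms(1,2) that by blast+
    then show ?thesis by (simp add: flagged_def mdeg_wmons)
  qed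
  have "{x \<in> C. flagged (2 ^ Suc n) T m R x} = {y}"
  proof (intro equalityI subsetI)
    fix x assume "x \<in> {x \<in> C. flagged (2 ^ Suc n) T m R x}"
    then show "x \<in> {y}" using *[of x] assms(7)[of x] by blast
  next
    fix x assume "x \<in> {y}"
    then show "x \<in> {x \<in> C. flagged (2 ^ Suc n) T m R x}" using *[of y] assms(3,6) by blast
  qed
  then have "par (flagged (2 ^ Suc n) T m R) C"
    by (simp add: par_def)
  then show ?thesis
    unfolding separated_def using assms(4,5) by blast
qed

text \<open>The tree edges are \<open>?b m\<close> (\<open>psi\<close> at \<open>a\<close> and at
  \<open>m\<close>), \<open>?c m\<close> (\<open>psi\<close> at \<open>a\<close>,
  \<open>theta\<close> at \<open>m\<close>) and \<open>?e\<close> (\<open>theta\<close> at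
  \<open>a\<close>, \<open>psi\<close> at \<open>s\<close>), which are 2 (|T| - 1) + 1 in number.
  The upper bound on \<open>card T\<close> lets a word of length \<open>n\<close> hold |T| - 1
  letters.\<close>

lemma support_basis_3:
  assumes T: "T \<subseteq> {..<k}" "3 \<le> card T" "card T \<le> Suc n"
  shows "\<exists>B. finite B \<and> card B = 2 * card T - 1 \<and> B \<subseteq> {x \<in> wmons k (Suc n). supp x = T}
    \<and> (\<forall>x\<in>wmons k (Suc n). supp x = T \<longrightarrow> spanned k B {x})
    \<and> (\<forall>C\<subseteq>B. C \<noteq> {} \<longrightarrow> separated T C)"
proof -
  have fin: "finite T" using T(1) finite_subset by blast
  have "T \<noteq> {}" using T(2) by auto
  then obtain a where a: "a \<in> T" by blast
  have "card (T - {a}) \<noteq> 0" using T(2) a fin by simp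
  then have "T - {a} \<noteq> {}" by (metis card.empty)
  then obtain s where s: "s \<in> T" "s \<noteq> a" by blast
  have lt: "x < k" if "x \<in> T" for x using T(1) that by blast
  let ?b = "\<lambda>m. cls k n a m (T - {a, m})" and ?c = "\<lambda>m. cls k n a m (T - {a})"
    and ?e = "cls k n a s (T - {s})"
  let ?T = "T - {a}"
  define B where "B = insert ?e (?b ` ?T \<union> ?c ` ?T)"
  have cT: "card ?T = card T - 1" using a fin by simp
  have c2: "card (T - {a, m}) = card T - 2" if "m \<in> ?T" for m
  proof -
    have "T - {a, m} = ?T - {m}" by blast
    then show ?thesis using that cT fin by simp
  qed
  have ne2: "T - {a, m} \<noteq> {}" if "m \<in> ?T" for m
  proof
    assume "T - {a, m} = {}"
    then have "card T - 2 = 0" using c2[OF that] by (simp only: card.empty)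
    then show False using T(2) by simp
  qed
  have b: "?b m \<in> wmons k (Suc n)" "supp (?b m) = T"
    "l < k \<Longrightarrow> psi (?b m ! l) \<longleftrightarrow> l = a \<or> l = m" "l < k \<Longrightarrow> \<not> theta (?b m ! l)" if m: "m \<in> ?T" for m l
  proof -
    have mT: "m \<in> T" "a \<noteq> m" using m by auto
    have "T - {a, m} \<subseteq> {..<k}" "card (T - {a, m}) \<le> n"
      using T c2[OF m] by auto
    note P = cls_props[OF lt[OF a] lt[OF mT(1)] mT(2) this(1) ne2[OF m] this(2)]
    show "?b m \<in> wmons k (Suc n)" by (rule P(1))
    show "supp (?b m) = T" unfolding P(2) using mT a by auto
    show "psi (?b m ! l) \<longleftrightarrow> l = a \<or> l = m" "\<not> theta (?b m ! l)" if "l < k"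
      unfolding P(3)[OF that] P(4)[OF that] by auto
  qed
  have c: "?c m \<in> wmons k (Suc n)" "supp (?c m) = T"
    "l < k \<Longrightarrow> psi (?c m ! l) \<longleftrightarrow> l = a" "l < k \<Longrightarrow> theta (?c m ! l) \<longleftrightarrow> l = m" if m: "m \<in> ?T" for m l
  proof -
    have mT: "m \<in> T" "a \<noteq> m" using m by auto
    have S: "?T \<subseteq> {..<k}" "card ?T \<le> n" "?T \<noteq> {}"
      using T cT m by auto
    note P = cls_props[OF lt[OF a] lt[OF mT(1)] mT(2) S(1,3,2)]
    show "?c m \<in> wmons k (Suc n)" by (rule P(1))
    show "supp (?c m) = T" unfolding P(2) using mT a by auto
    show "psi (?c m ! l) \<longleftrightarrow> l = a" "theta (?c m ! l) \<longleftrightarrow> l = m" if "l < k"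
      unfolding P(3)[OF that] P(4)[OF that] using mT by auto
  qed
  have e: "?e \<in> wmons k (Suc n)" "supp ?e = T"
    "l < k \<Longrightarrow> psi (?e ! l) \<longleftrightarrow> l = s" "l < k \<Longrightarrow> theta (?e ! l) \<longleftrightarrow> l = a" for l
  proof -
    have "card (T - {s}) = card T - 1" using s fin by simp
    then have S: "T - {s} \<subseteq> {..<k}" "card (T - {s}) \<le> n" "T - {s} \<noteq> {}"
      using T s a by auto
    note P = cls_props[OF lt[OF a] lt[OF s(1)] s(2)[symmetric] S(1,3,2)]
    show "?e \<in> wmons k (Suc n)" by (rule P(1))
    show "supp ?e = T" unfolding P(2) using s a by auto
    show "psi (?e ! l) \<longleftrightarrow> l = s" "theta (?e ! l) \<longleftrightarrow> l = a" if "l < k"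
      unfolding P(3)[OF that] P(4)[OF that] using s a by auto
  qed
  have "inj_on ?b ?T"
  proof (rule inj_onI)
    fix m m' assume m: "m \<in> ?T" "m' \<in> ?T" "?b m = ?b m'"
    then have "m < k" using lt by blast
    then show "m = m'" using b(3)[OF m(1), of m] b(3)[OF m(2), of m] m by simp
  qed
  moreover have "inj_on ?c ?T"
  proof (rule inj_onI)
    fix m m' assume m: "m \<in> ?T" "m' \<in> ?T" "?c m = ?c m'"
    then have "m < k" using lt by blast
    then show "m = m'" using c(4)[OF m(1), of m] c(4)[OF m(2), of m] m by simp
  qed
  moreover have "?b ` ?T \<inter> ?c ` ?T = {}"
  proof -
    have "?b m \<noteq> ?c m'" if "m \<in> ?T" "m' \<in> ?T" for m m'
      using b(4)[OF that(1), of m'] c(4)[OF that(2), of m'] lt[of m'] that(2) by force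
    then show ?thesis by blast
  qed
  moreover have "?e \<notin> ?b ` ?T \<union> ?c ` ?T"
  proof -
    have "psi (?b m ! a)" "psi (?c m ! a)" if "m \<in> ?T" for m
      using b(3)[OF that lt[OF a]] c(3)[OF that lt[OF a]] by simp_all
    moreover have "\<not> psi (?e ! a)" using e(3)[OF lt[OF a]] s(2) by simp
    ultimately show ?thesis by (metis (no_types, lifting) UnE imageE)
  qed
  ultimately have "card B = 2 * card T - 1"
    using fin T(2) cT by (simp add: B_def card_Un_disjoint card_image)
  moreover have "finite B" using fin by (simp add: B_def)
  moreover have sub: "B \<subseteq> {x \<in> wmons k (Suc n). supp x = T}"
    using b(1,2) c(1,2) e(1,2) by (auto simp: B_def)
  moreover have "spanned k B {x}" if x: "x \<in> wmons k (Suc n)" "supp x = T" for x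
  proof -
    obtain i j ws where p: "i < k" "j < k" "i \<noteq> j" "length ws = n" "set ws \<subseteq> {..<k}" "x = pmon k i j ws"
      using x(1) wmons_ex_pmon by blast
    then have T': "T = {i, j} \<union> set ws" using x(2) supp_pmon by metis
    have "spanned k B {cls k n i j (set ws)}"
    proof (rule spanned_support[OF T(1,2) a s(1) s(2)[symmetric]])
      show "card (set ws) \<le> n" using p(4) card_length[of ws] by simp
    qed (use T' p in \<open>auto simp: B_def\<close>)
    moreover have "hcong k {x} {cls k n i j (set ws)}"
      using p n by (simp add: pmon_hcong_cls)
    ultimately show ?thesis by (rule spanned_hcong[rotated])
  qed
  moreover have "separated T C" if C: "C \<subseteq> B" "C \<noteq> {}" for C
  proof -
    have CB: "C \<subseteq> wmons k (Suc n)" "\<And>x. x \<in> C \<Longrightarrow> supp x = T"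
      using C(1) sub by auto
    \<comment> \<open>Leaves of the tree are peeled off: \<open>theta\<close> at \<open>a\<close>
      occurs only in \<open>?e\<close>; without \<open>?e\<close>, \<open>psi\<close> at
      \<open>m\<close> occurs only in \<open>?b m\<close>; finally \<open>theta\<close> at
      \<open>m\<close> singles out \<open>?c m\<close>.\<close>
    consider "?e \<in> C" | m where "m \<in> ?T" "?b m \<in> C" "?e \<notin> C"
      | m where "m \<in> ?T" "?c m \<in> C" "C \<subseteq> ?c ` ?T"
      using C unfolding B_def by blast
    then show ?thesis
    proof cases
      case 1
      show ?thesis
      proof (rule separatedI[OF CB 1, of a theta])
        fix x assume "x \<in> C" "theta (x ! a)"
        then show "x = ?e"
          using C(1) b(4)[of _ a] c(4)[of _ a] lt[OF a] unfolding B_def by blast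
      qed (use e lt a in auto)
    next
      case 2
      show ?thesis
      proof (rule separatedI[OF CB 2(2), of m psi])
        fix x assume "x \<in> C" "psi (x ! m)"
        then show "x = ?b m"
          using C(1) b(3)[of _ m] c(3)[of _ m] lt[of m] 2 unfolding B_def by blast
      qed (use b lt 2 in auto)
    next
      case 3
      show ?thesis
      proof (rule separatedI[OF CB 3(2), of m theta])
        fix x assume "x \<in> C" "theta (x ! m)"
        then show "x = ?c m"
          using 3 c(4)[of _ m] lt[of m] by blast
      qed (use c lt 3 in auto)
    qed
  qed
  ultimately show ?thesis by blast
qed

lemma subset_doubleton: "X \<subseteq> {a, s} \<Longrightarrow> X \<noteq> {} \<Longrightarrow> X = {a} \<or> X = {s} \<or> X = {a, s}"
  by (cases "a \<in> X"; cases "s \<in> X") blast+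

text \<open>There are no triangles, and two flags \<open>psi\<close> are impossible because the word
  must use a letter from \<open>T\<close>. The three remaining classes form a path on the four
  flags, so they are independent as they stand.\<close>

lemma support_basis_2:
  assumes T: "T \<subseteq> {..<k}" "card T = 2"
  shows "\<exists>B. finite B \<and> card B = 3 \<and> B \<subseteq> {x \<in> wmons k (Suc n). supp x = T}
    \<and> (\<forall>x\<in>wmons k (Suc n). supp x = T \<longrightarrow> spanned k B {x})
    \<and> (\<forall>C\<subseteq>B. C \<noteq> {} \<longrightarrow> separated T C)"
proof -
  obtain a s where as: "T = {a, s}" "a \<noteq> s" using T(2) by (auto simp: card_2_iff)
  have lt: "a < k" "s < k" using T(1) as by auto
  let ?a = "cls k n a s {a}" and ?s = "cls k n a s {s}" and ?t = "cls k n a s {a, s}"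
  define B where "B = {?a, ?s, ?t}"
  have a: "?a \<in> wmons k (Suc n)" "supp ?a = T"
    "l < k \<Longrightarrow> psi (?a ! l) \<longleftrightarrow> l = s" "l < k \<Longrightarrow> theta (?a ! l) \<longleftrightarrow> l = a" for l
    using cls_props[of a s "{a}"] lt as n by auto
  have s: "?s \<in> wmons k (Suc n)" "supp ?s = T"
    "l < k \<Longrightarrow> psi (?s ! l) \<longleftrightarrow> l = a" "l < k \<Longrightarrow> theta (?s ! l) \<longleftrightarrow> l = s" for l
    using cls_props[of a s "{s}"] lt as n by auto
  have t: "?t \<in> wmons k (Suc n)" "supp ?t = T"
    "l < k \<Longrightarrow> \<not> psi (?t ! l)" "l < k \<Longrightarrow> theta (?t ! l) \<longleftrightarrow> l = a \<or> l = s" for l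
    using cls_props[of a s "{a, s}"] lt as n by auto
  have "?a \<noteq> ?s" "?a \<noteq> ?t" "?s \<noteq> ?t"
    using a(3)[of s] s(3)[of s] t(3)[of s] s(3)[of a] t(3)[of a] lt as(2) by metis+
  then have "card B = 3" by (simp add: B_def)
  moreover have "finite B" by (simp add: B_def)
  moreover have sub: "B \<subseteq> {x \<in> wmons k (Suc n). supp x = T}"
    using a(1,2) s(1,2) t(1,2) by (auto simp: B_def)
  moreover have "spanned k B {x}" if x: "x \<in> wmons k (Suc n)" "supp x = T" for x
  proof -
    obtain i j ws where p: "i < k" "j < k" "i \<noteq> j" "length ws = n" "set ws \<subseteq> {..<k}" "x = pmon k i j ws"
      using x(1) wmons_ex_pmon by blast
    then have "{a, s} = {i, j} \<union> set ws" using x(2) supp_pmon as(1) by metis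
    moreover have "set ws \<noteq> {}" using p(4) n by auto
    ultimately have ws: "set ws \<subseteq> {a, s}" "set ws \<noteq> {}" "i \<in> {a, s}" "j \<in> {a, s}" by auto
    then have "set ws = {a} \<or> set ws = {s} \<or> set ws = {a, s}"
      by (metis subset_doubleton)
    then have "cls k n a s (set ws) \<in> B"
      unfolding B_def by auto
    moreover have "i = a \<and> j = s \<or> i = s \<and> j = a" using ws(3,4) p(3) by auto
    ultimately have "cls k n i j (set ws) \<in> B"
      using cls_commute by metis
    moreover have "hcong k {x} {cls k n i j (set ws)}"
      using p n by (simp add: pmon_hcong_cls)
    ultimately show ?thesis by (meson spanned_hcong spanned_mem)
  qed
  moreover have "separated T C" if C: "C \<subseteq> B" "C \<noteq> {}" for C
  proof -
    have CB: "C \<subseteq> wmons k (Suc n)" "\<And>x. x \<in> C \<Longrightarrow> supp x = T"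
      using C(1) sub by auto
    consider "?a \<in> C" | "?s \<in> C" | "C = {?t}"
      using C unfolding B_def by blast
    then show ?thesis
    proof cases
      case 1
      show ?thesis
      proof (rule separatedI[OF CB 1, of s psi])
        fix x assume "x \<in> C" "psi (x ! s)"
        then show "x = ?a"
          using C(1) s(3)[of s] t(3)[of s] lt as(2) unfolding B_def by blast
      qed (use a lt in auto)
    next
      case 2
      show ?thesis
      proof (rule separatedI[OF CB 2, of a psi])
        fix x assume "x \<in> C" "psi (x ! a)"
        then show "x = ?s"
          using C(1) a(3)[of a] t(3)[of a] lt as(2) unfolding B_def by blast
      qed (use s lt in auto)
    next
      case 3
      show ?thesis
        by (rule separatedI[OF CB, of ?t a theta]) (use 3 t lt in auto)
    qed
  qed
  ultimately show ?thesis by blast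
qed

lemma support_basis:
  assumes "T \<subseteq> {..<k}" "2 \<le> card T" "card T \<le> Suc n"
  shows "\<exists>B. finite B \<and> card B = 2 * card T - 1 \<and> B \<subseteq> {x \<in> wmons k (Suc n). supp x = T}
    \<and> (\<forall>x\<in>wmons k (Suc n). supp x = T \<longrightarrow> spanned k B {x})
    \<and> (\<forall>C\<subseteq>B. C \<noteq> {} \<longrightarrow> separated T C)"
proof (cases "card T = 2")
  case True
  then show ?thesis using support_basis_2[OF assms(1)] by simp
next
  case False
  then show ?thesis using support_basis_3 assms by simp
qed

end

lemma singleton_image: "{{y} | y. P y} = (\<lambda>y. {y}) ` {y. P y}"
  by blast

lemma odd_if_flagged: "R = psi \<or> R = theta \<Longrightarrow> R a \<Longrightarrow> odd a"
  by (auto simp: psi_def theta_def)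

section \<open>Dimensions of the quotients and tests for admissibility\<close>

context cls_context
begin

abbreviation "\<omega> \<equiv> omega_d (Suc n)"

definition Pw_mons :: "mono set" where
  "Pw_mons = {y. length y = k \<and> mdeg y = 2 ^ Suc n \<and> lex_le (wt y) \<omega>}"

lemma finite_Pw_mons: "finite Pw_mons"
proof (rule finite_subset)
  show "Pw_mons \<subseteq> {y. set y \<subseteq> {..2 ^ Suc n} \<and> length y = k}"
  proof
    fix y assume "y \<in> Pw_mons"
    then have y: "length y = k" "sum_list y = 2 ^ Suc n" by (auto simp: Pw_mons_def mdeg_def)
    have "set y \<subseteq> {..2 ^ Suc n}"
      using member_le_sum_list[of _ y] unfolding y(2) by blast
    then show "y \<in> {y. set y \<subseteq> {..2 ^ Suc n} \<and> length y = k}" using y(1) by blast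
  qed
qed (rule finite_lists_length_eq, simp)

lemma Pw_eq: "Pw k \<omega> = Pow Pw_mons"
proof -
  have "Pw k \<omega> = {f. finite f \<and> f \<subseteq> Pw_mons}"
    unfolding Pw_def singleton_image f2_span_singletons wdeg_omega_d Pw_mons_def by simp
  moreover have "finite f" if "f \<subseteq> Pw_mons" for f
    by (rule finite_subset[OF that finite_Pw_mons])
  ultimately show ?thesis by auto
qed

lemma wmons_subset_Pw_mons: "wmons k (Suc n) \<subseteq> Pw_mons"
proof (rule subsetI)
  fix x assume x: "x \<in> wmons k (Suc n)"
  then show "x \<in> Pw_mons"
    using mdeg_wmons[OF x] by (simp add: Pw_mons_def wmons_def lex_le_def)
qed

lemma Pw_mons_cases:
  assumes "y \<in> Pw_mons"
  obtains "y \<in> wmons k (Suc n)" | "{y} \<in> hit k" "lex_less (wt y) \<omega>"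
proof (cases "wt y = \<omega>")
  case True
  then have "y \<in> wmons k (Suc n)" using assms by (simp add: Pw_mons_def wmons_def)
  then show ?thesis by (rule that(1))
next
  case False
  then have l: "lex_less (wt y) \<omega>" using assms by (auto simp: Pw_mons_def lex_le_def)
  have y: "length y = k" "mdeg y = 2 ^ Suc n" using assms by (auto simp: Pw_mons_def)
  have "{y} \<in> hit k"
  proof (rule hit_if_all_even[OF y(1)])
    show "mdeg y \<noteq> 0" by (simp add: y(2))
    show "even (y ! j)" if "j < k" for j
      using even_if_wt_less_omega_d[OF y(2) l] that y(1) by simp
  qed
  with l show ?thesis using that(2) by blast
qed

lemma subspace_Pw: "f2_subspace (Pw k \<omega>)"
  unfolding Pw_def by (rule f2_subspace_span)

lemma subspace_hit: "f2_subspace (hit k)"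
  unfolding hit_def by (rule f2_subspace_span)

text \<open>Monomials of smaller weight have only even exponents, so all of \<open>Pw_minus\<close>
  is absorbed by the hit polynomials.\<close>

lemma QW_eq: "QW k \<omega> = hit k \<inter> Pw k \<omega>"
proof -
  have sub: "f2_subspace (hit k \<inter> Pw k \<omega>)"
    by (intro f2_subspace_Int subspace_hit subspace_Pw)
  have "Pw_minus k \<omega> \<subseteq> hit k \<inter> Pw k \<omega>"
    unfolding Pw_minus_def
  proof (rule f2_span_least[OF sub], rule subsetI)
    fix f assume "f \<in> {{y} | y. length y = k \<and> mdeg y = wdeg \<omega> \<and> lex_less (wt y) \<omega>}"
    then obtain y where y: "f = {y}" "length y = k" "mdeg y = 2 ^ Suc n" "lex_less (wt y) \<omega>"
      unfolding wdeg_omega_d by blast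
    have "{y} \<in> hit k"
    proof (rule hit_if_all_even[OF y(2)])
      show "mdeg y \<noteq> 0" by (simp add: y(3))
      show "even (y ! j)" if "j < k" for j
        using even_if_wt_less_omega_d[OF y(3,4)] that y(2) by simp
    qed
    moreover have "{y} \<in> Pw k \<omega>"
      using y by (simp add: Pw_eq Pw_mons_def lex_le_def)
    ultimately show "f \<in> hit k \<inter> Pw k \<omega>"
      by (simp add: y(1))
  qed
  then have "hit k \<inter> Pw k \<omega> \<union> Pw_minus k \<omega> = hit k \<inter> Pw k \<omega>" by blast
  then show ?thesis
    unfolding QW_def using f2_span_subspace[OF sub] by simp
qed

lemma supp_wmons:
  assumes "x \<in> wmons k (Suc n)"
  shows "supp x \<subseteq> {..<k}" "2 \<le> card (supp x)"
proof -
  obtain i j ws where p: "i < k" "j < k" "i \<noteq> j" "set ws \<subseteq> {..<k}" "x = pmon k i j ws"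
    by (rule wmons_ex_pmon[OF assms])
  have s: "supp x = {i, j} \<union> set ws"
    unfolding p(5) by (rule supp_pmon[OF p(1,2,4)])
  show "supp x \<subseteq> {..<k}" unfolding s using p(1,2,4) by simp
  have "card {i, j} \<le> card (supp x)"
    unfolding s by (intro card_mono) auto
  then show "2 \<le> card (supp x)" using p(3) by simp
qed

definition supports_basis :: "nat set set \<Rightarrow> mono set \<Rightarrow> bool" where
  "supports_basis \<T> B \<longleftrightarrow> finite B \<and> card B = (\<Sum>T\<in>\<T>. 2 * card T - 1)
    \<and> B \<subseteq> {x \<in> wmons k (Suc n). supp x \<in> \<T>}
    \<and> (\<forall>x\<in>wmons k (Suc n). supp x \<in> \<T> \<longrightarrow> spanned k B {x})
    \<and> (\<forall>C\<subseteq>B. C \<noteq> {} \<longrightarrow> (\<exists>T\<in>\<T>. separated T C))"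

text \<open>A flag functional sees only monomials of one support, so the bases for the separate
  supports can be united: some functional detects the part of \<open>C\<close> at a support and
  ignores the rest.\<close>

lemma ex_supports_basis:
  assumes k: "k \<le> Suc n" and \<T>: "\<And>T. T \<in> \<T> \<Longrightarrow> T \<subseteq> {..<k} \<and> 2 \<le> card T"
  shows "\<exists>B. supports_basis \<T> B"
proof -
  have fin\<T>: "finite \<T>"
    by (rule finite_subset[of _ "Pow {..<k}"]) (use \<T> in auto)
  let ?P = "\<lambda>T B. finite B \<and> card B = 2 * card T - 1 \<and> B \<subseteq> {x \<in> wmons k (Suc n). supp x = T}
    \<and> (\<forall>x\<in>wmons k (Suc n). supp x = T \<longrightarrow> spanned k B {x})
    \<and> (\<forall>C\<subseteq>B. C \<noteq> {} \<longrightarrow> separated T C)"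
  have "\<exists>B. ?P T B" if "T \<in> \<T>" for T
  proof (rule support_basis)
    show "T \<subseteq> {..<k}" "2 \<le> card T" using \<T>[OF that] by simp_all
    then show "card T \<le> Suc n" using card_mono[of "{..<k}" T] k by simp
  qed
  then have "\<forall>T\<in>\<T>. \<exists>B. ?P T B" by (rule ballI)
  from bchoice[OF this] obtain F where F: "\<forall>T\<in>\<T>. ?P T (F T)" by (rule exE)
  have F: "finite (F T)" "card (F T) = 2 * card T - 1" "F T \<subseteq> {x \<in> wmons k (Suc n). supp x = T}"
    "\<And>x. x \<in> wmons k (Suc n) \<Longrightarrow> supp x = T \<Longrightarrow> spanned k (F T) {x}"
    "\<And>C. C \<subseteq> F T \<Longrightarrow> C \<noteq> {} \<Longrightarrow> separated T C" if "T \<in> \<T>" for T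
    using bspec[OF F that] by simp_all
  have suppF: "supp x = T" if "x \<in> F T" "T \<in> \<T>" for x T
    using F(3)[OF that(2)] that(1) by blast
  show ?thesis
    unfolding supports_basis_def
  proof (intro exI[of _ "\<Union>T\<in>\<T>. F T"] conjI ballI allI impI)
    show "finite (\<Union>T\<in>\<T>. F T)" using fin\<T> F(1) by blast
    have "card (\<Union>T\<in>\<T>. F T) = (\<Sum>T\<in>\<T>. card (F T))"
    proof (rule card_UN_disjoint[OF fin\<T>])
      show "\<forall>T\<in>\<T>. \<forall>T'\<in>\<T>. T \<noteq> T' \<longrightarrow> F T \<inter> F T' = {}"
        using suppF by (metis disjoint_iff)
    qed (use F(1) in blast)
    also have "\<dots> = (\<Sum>T\<in>\<T>. 2 * card T - 1)"
      by (rule sum.cong) (simp_all add: F(2))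
    finally show "card (\<Union>T\<in>\<T>. F T) = (\<Sum>T\<in>\<T>. 2 * card T - 1)" .
    show "(\<Union>T\<in>\<T>. F T) \<subseteq> {x \<in> wmons k (Suc n). supp x \<in> \<T>}"
      using F(3) by blast
    show "spanned k (\<Union>T\<in>\<T>. F T) {x}" if "x \<in> wmons k (Suc n)" "supp x \<in> \<T>" for x
      using F(4)[OF that(2,1) refl] that(2) unfolding spanned_def by (meson UN_upper subset_trans)
  next
    fix C assume C: "C \<subseteq> (\<Union>T\<in>\<T>. F T)" "C \<noteq> {}"
    then obtain T where T: "T \<in> \<T>" "C \<inter> F T \<noteq> {}" by blast
    have "{x \<in> C \<inter> F T. flagged N T m R x} = {x \<in> C. flagged N T m R x}" for N m R
    proof -
      have "x \<in> F T" if x: "x \<in> C" "supp x = T" for x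
      proof -
        obtain T' where "T' \<in> \<T>" "x \<in> F T'" using C(1) x(1) by blast
        with suppF x(2) show ?thesis by metis
      qed
      then show ?thesis by (auto simp: flagged_def)
    qed
    moreover have "separated T (C \<inter> F T)" by (rule F(5)[OF T(1) Int_lower2 T(2)])
    ultimately have "separated T C" by (simp add: separated_def par_def)
    then show "\<exists>T\<in>\<T>. separated T C" using T(1) by blast
  qed
qed

lemma separated_not_hit: "separated T C \<Longrightarrow> C \<notin> hit k"
  unfolding separated_def by (metis hit_flagged)

text \<open>Serves both dimensions: the full quotient takes all supports with at least two elements,
  the positive part only the full support.\<close>

lemma quot_dim_supports:
  assumes k: "k \<le> Suc n" and \<T>: "\<And>T. T \<in> \<T> \<Longrightarrow> T \<subseteq> {..<k} \<and> 2 \<le> card T"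
    and V: "V = f2_span ((\<lambda>x. {x}) ` {x \<in> wmons k (Suc n). supp x \<in> \<T>} \<union> QW k \<omega>)"
  shows "quot_dim V (QW k \<omega>) = (\<Sum>T\<in>\<T>. 2 * card T - 1)"
proof -
  obtain B where "supports_basis \<T> B"
    using ex_supports_basis[OF k \<T>] by (rule exE)
  then have B: "finite B" "card B = (\<Sum>T\<in>\<T>. 2 * card T - 1)"
    "B \<subseteq> {x \<in> wmons k (Suc n). supp x \<in> \<T>}"
    "\<forall>x\<in>wmons k (Suc n). supp x \<in> \<T> \<longrightarrow> spanned k B {x}"
    "\<forall>C\<subseteq>B. C \<noteq> {} \<longrightarrow> (\<exists>T\<in>\<T>. separated T C)"
    unfolding supports_basis_def by simp_all
  let ?B = "(\<lambda>x. {x}) ` B"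
  have W: "f2_subspace (QW k \<omega>)"
    unfolding QW_def by (rule f2_subspace_span)
  have finW: "finite (QW k \<omega>)"
    by (rule finite_subset[of _ "Pow Pw_mons"]) (simp_all add: finite_Pw_mons QW_eq Pw_eq)
  have BV: "?B \<union> QW k \<omega> \<subseteq> V"
    unfolding V
  proof (rule subsetI, rule f2_span_superset)
    fix f assume "f \<in> ?B \<union> QW k \<omega>"
    then show "f \<in> (\<lambda>x. {x}) ` {x \<in> wmons k (Suc n). supp x \<in> \<T>} \<union> QW k \<omega>"
      using image_mono[OF B(3), of "\<lambda>x. {x}"] by blast
  qed
  have "quot_dim V (QW k \<omega>) = card ?B"
  proof (rule quot_dim_eq_card[OF W finW])
    show "f2_span (?B \<union> QW k \<omega>) = V"
    proof (rule equalityI)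
      show "f2_span (?B \<union> QW k \<omega>) \<subseteq> V"
        using BV unfolding V by (rule f2_span_least[OF f2_subspace_span])
      show "V \<subseteq> f2_span (?B \<union> QW k \<omega>)"
        unfolding V
      proof (rule f2_span_least[OF f2_subspace_span], rule Un_least)
        show "(\<lambda>x. {x}) ` {x \<in> wmons k (Suc n). supp x \<in> \<T>} \<subseteq> f2_span (?B \<union> QW k \<omega>)"
        proof (rule image_subsetI)
          fix x assume "x \<in> {x \<in> wmons k (Suc n). supp x \<in> \<T>}"
          then have x: "x \<in> wmons k (Suc n)" "supp x \<in> \<T>" by simp_all
          obtain C where C: "C \<subseteq> B" "padd {x} C \<in> hit k"
            using B(4) x unfolding spanned_def hcong_def by blast
          have "padd {x} C \<subseteq> Pw_mons"
          proof (rule padd_subset)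
            show "{x} \<subseteq> Pw_mons" using x(1) wmons_subset_Pw_mons by blast
            show "C \<subseteq> Pw_mons" using C(1) B(3) wmons_subset_Pw_mons by blast
          qed
          then have "padd {x} C \<in> QW k \<omega>"
            using C(2) by (simp add: QW_eq Pw_eq)
          then have 1: "padd {x} C \<in> f2_span (?B \<union> QW k \<omega>)"
            by (intro f2_span_superset) simp
          have "C \<in> f2_span ?B"
            unfolding f2_span_singletons using C(1) finite_subset[OF C(1) B(1)] by simp
          then have 2: "C \<in> f2_span (?B \<union> QW k \<omega>)"
            by (rule subsetD[OF f2_span_mono[OF Un_upper1]])
          have "{x} = padd (padd {x} C) C" by (simp add: padd_assoc)
          then show "{x} \<in> f2_span (?B \<union> QW k \<omega>)"
            using f2_span_padd[OF 1 2] by simp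
        qed
        show "QW k \<omega> \<subseteq> f2_span (?B \<union> QW k \<omega>)"
          by (rule subsetI, rule f2_span_superset) simp
      qed
    qed
  next
    fix C' assume "C' \<subseteq> ?B" "C' \<noteq> {}"
    then obtain C where C: "C \<subseteq> B" "C' = (\<lambda>x. {x}) ` C" "C \<noteq> {}"
      by (metis image_is_empty subset_image_iff)
    then have "C \<notin> hit k" using B(5) C(1,3) separated_not_hit by blast
    then show "f2_sum C' \<notin> QW k \<omega>"
      unfolding C(2) f2_sum_singletons QW_eq by blast
  qed (use B(1) BV in auto)
  also have "card ?B = card B"
    by (intro card_image) simp
  finally show ?thesis using B(2) by simp
qed

lemma dim_QP_eq:
  assumes "k \<le> Suc n"
  shows "dim_QP k \<omega> = (\<Sum>T | T \<subseteq> {..<k} \<and> 2 \<le> card T. 2 * card T - 1)"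
  unfolding dim_QP_def
proof (rule quot_dim_supports[OF assms])
  let ?G = "(\<lambda>x. {x}) ` {x \<in> wmons k (Suc n). supp x \<in> {T. T \<subseteq> {..<k} \<and> 2 \<le> card T}} \<union> QW k \<omega>"
  show "Pw k \<omega> = f2_span ?G"
  proof (rule equalityI)
    have "{{y} | y. length y = k \<and> mdeg y = wdeg \<omega> \<and> lex_le (wt y) \<omega>} \<subseteq> ?G"
    proof (rule subsetI)
      fix f assume "f \<in> {{y} | y. length y = k \<and> mdeg y = wdeg \<omega> \<and> lex_le (wt y) \<omega>}"
      then obtain y where f: "f = {y}" and y: "y \<in> Pw_mons"
        unfolding Pw_mons_def wdeg_omega_d by blast
      from y show "f \<in> ?G"
      proof (cases rule: Pw_mons_cases)
        case 1
        then show ?thesis using supp_wmons[OF 1] f by blast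
      next
        case 2
        then show ?thesis using y f by (simp add: QW_eq Pw_eq)
      qed
    qed
    then show "Pw k \<omega> \<subseteq> f2_span ?G"
      unfolding Pw_def by (rule f2_span_mono)
    show "f2_span ?G \<subseteq> Pw k \<omega>"
      by (rule f2_span_least[OF subspace_Pw]) (use wmons_subset_Pw_mons in \<open>auto simp: Pw_eq QW_eq\<close>)
  qed
qed simp

lemma dim_QP_plus_eq:
  assumes "k \<le> Suc n" "2 \<le> k"
  shows "dim_QP_plus k \<omega> = 2 * k - 1"
proof -
  let ?G = "(\<lambda>x. {x}) ` {x \<in> wmons k (Suc n). supp x \<in> {{..<k}}}"
  have full: "supp y = {..<k} \<longleftrightarrow> (\<forall>j<k. 0 < y ! j)" if "length y = k" for y
    using that by (auto simp: supp_def)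
  have "dim_QP_plus k \<omega> = (\<Sum>T\<in>{{..<k}}. 2 * card T - 1)"
    unfolding dim_QP_plus_def
  proof (rule quot_dim_supports[OF assms(1)])
    show "f2_span (Pplus k \<inter> Pw k \<omega> \<union> QW k \<omega>) = f2_span (?G \<union> QW k \<omega>)"
    proof (rule equalityI)
      show "f2_span (Pplus k \<inter> Pw k \<omega> \<union> QW k \<omega>) \<subseteq> f2_span (?G \<union> QW k \<omega>)"
      proof (rule f2_span_least[OF f2_subspace_span], rule Un_least)
        show "QW k \<omega> \<subseteq> f2_span (?G \<union> QW k \<omega>)"
          by (rule subsetI, rule f2_span_superset) simp
        show "Pplus k \<inter> Pw k \<omega> \<subseteq> f2_span (?G \<union> QW k \<omega>)"
        proof
          fix f assume "f \<in> Pplus k \<inter> Pw k \<omega>"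
          then have f: "finite f" "\<forall>y\<in>f. length y = k \<and> (\<forall>j<k. 0 < y ! j)" "f \<subseteq> Pw_mons"
            unfolding Pplus_def singleton_image f2_span_singletons Pw_eq by auto
          have "(\<lambda>y. {y}) ` f \<subseteq> ?G \<union> QW k \<omega>"
          proof (rule image_subsetI)
            fix y assume y: "y \<in> f"
            then have yP: "y \<in> Pw_mons" using f(3) by blast
            then show "{y} \<in> ?G \<union> QW k \<omega>"
            proof (cases rule: Pw_mons_cases)
              case 1
              then show ?thesis using f(2) y full[of y] by simp
            next
              case 2
              then show ?thesis using yP by (simp add: QW_eq Pw_eq)
            qed
          qed
          then have "f2_span ((\<lambda>y. {y}) ` f) \<subseteq> f2_span (?G \<union> QW k \<omega>)"
            by (rule f2_span_mono)
          then show "f \<in> f2_span (?G \<union> QW k \<omega>)"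
            unfolding f2_span_singletons using f(1) by blast
        qed
      qed
      have "?G \<subseteq> Pplus k \<inter> Pw k \<omega>"
      proof (rule image_subsetI)
        fix x assume "x \<in> {x \<in> wmons k (Suc n). supp x \<in> {{..<k}}}"
        then have x: "x \<in> wmons k (Suc n)" "supp x = {..<k}" by simp_all
        then have "length x = k" by (simp add: wmons_def)
        then show "{x} \<in> Pplus k \<inter> Pw k \<omega>"
          using x full wmons_subset_Pw_mons
          unfolding Pplus_def singleton_image f2_span_singletons Pw_eq by auto
      qed
      then show "f2_span (?G \<union> QW k \<omega>) \<subseteq> f2_span (Pplus k \<inter> Pw k \<omega> \<union> QW k \<omega>)"
        by (intro f2_span_mono) blast
    qed
  qed (use assms(2) in auto)
  then show ?thesis by simp
qed

text \<open>The converse of \<open>hit_flagged\<close> for this weight. Modulo hit polynomials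
  \<open>f\<close> is a set \<open>C\<close> of basis monomials; every functional vanishes on
  \<open>C\<close> too, but a nonempty \<open>C\<close> is separated.\<close>

lemma hit_if_flags_vanish:
  assumes k: "k \<le> Suc n" and f: "f \<subseteq> wmons k (Suc n)" "finite f"
    and van: "\<And>T m R. m < k \<Longrightarrow> R = psi \<or> R = theta \<Longrightarrow> \<not> par (flagged (2 ^ Suc n) T m R) f"
  shows "f \<in> hit k"
proof -
  let ?\<T> = "{T. T \<subseteq> {..<k} \<and> 2 \<le> card T}"
  have "\<And>T. T \<in> ?\<T> \<Longrightarrow> T \<subseteq> {..<k} \<and> 2 \<le> card T" by simp
  from ex_supports_basis[OF k this] obtain B where "supports_basis ?\<T> B"
    by (rule exE)
  then have B: "finite B" "\<forall>x\<in>wmons k (Suc n). supp x \<in> ?\<T> \<longrightarrow> spanned k B {x}"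
    "\<forall>C\<subseteq>B. C \<noteq> {} \<longrightarrow> (\<exists>T\<in>?\<T>. separated T C)"
    unfolding supports_basis_def by simp_all
  have B2: "spanned k B {x}" if "x \<in> wmons k (Suc n)" for x
    using B(2) supp_wmons[OF that] that by simp
  have "spanned k B f"
    using f(2,1)
  proof (induction f)
    case empty
    show ?case unfolding spanned_def by (intro exI[of _ "{}"]) simp
  next
    case (insert x f)
    then have "insert x f = padd {x} f" by (auto simp: padd_def)
    moreover have "spanned k B {x}" "spanned k B f"
      using insert.prems insert.IH B2 by simp_all
    ultimately show ?case using spanned_padd by simp
  qed
  then obtain C where C: "C \<subseteq> B" "padd f C \<in> hit k"
    unfolding spanned_def hcong_def by blast
  have "C = {}"
  proof (rule ccontr)
    assume "C \<noteq> {}"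
    then obtain T where "separated T C" using B(3) C(1) by blast
    then obtain m R where T: "m < k" "R = psi \<or> R = theta" "par (flagged (2 ^ Suc n) T m R) C"
      unfolding separated_def by (elim exE conjE) (rule that)
    have "\<not> par (flagged (2 ^ Suc n) T m R) (padd f C)"
      by (rule hit_flagged[OF C(2) T(1,2)])
    then show False
      using T van[OF T(1,2)] f(2) finite_subset[OF C(1) B(1)] by (simp add: par_padd)
  qed
  then show ?thesis using C by simp
qed

text \<open>Membership in the hit polynomials has become a parity count of flags, so a reduction of
  \<open>u\<close> needs only smaller monomials of the same support whose flags balance those of
  \<open>u\<close>.\<close>

lemma not_admissibleI:
  assumes k: "k \<le> Suc n" and u: "u \<in> wmons k (Suc n)"
    and vs: "\<And>v. v \<in> set vs \<Longrightarrow> v \<in> wmons k (Suc n) \<and> supp v = supp u \<and> lex_less (sigma v) (sigma u)"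
    and ev: "\<And>m R. m < k \<Longrightarrow> R = psi \<or> R = theta \<Longrightarrow> even (length (filter (\<lambda>x. R (x ! m)) (u # vs)))"
  shows "\<not> admissible k u"
proof -
  let ?f = "foldr padd (map (\<lambda>v. {v}) vs) {u}"
  have "foldr padd (map (\<lambda>v. {v}) ws) {u} \<subseteq> wmons k (Suc n)" if "set ws \<subseteq> set vs" for ws
    using that
  proof (induction ws)
    case (Cons v ws)
    then have "{v} \<subseteq> wmons k (Suc n)" using vs[of v] by simp
    with Cons show ?case by (simp add: padd_subset)
  qed (simp add: u)
  then have sub: "?f \<subseteq> wmons k (Suc n)" by simp
  have van: "\<not> par (flagged (2 ^ Suc n) T m R) ?f" if "m < k" "R = psi \<or> R = theta" for T m R
  proof -
    have fl: "flagged (2 ^ Suc n) T m R x \<longleftrightarrow> T = supp u \<and> R (x ! m)" if "x \<in> set (u # vs)" for x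
    proof -
      have "x \<in> wmons k (Suc n)" "supp x = supp u" using that u vs[of x] by auto
      then show ?thesis using mdeg_wmons by (auto simp: flagged_def)
    qed
    have "filter (flagged (2 ^ Suc n) T m R) (u # vs) = filter (\<lambda>x. T = supp u \<and> R (x ! m)) (u # vs)"
      by (rule filter_cong[OF refl fl])
    then have "even (length (filter (flagged (2 ^ Suc n) T m R) (u # vs)))"
      using ev[OF that] by (cases "T = supp u") simp_all
    then show ?thesis
      by (cases "flagged (2 ^ Suc n) T m R u") (simp_all add: foldr_padd_par)
  qed
  have "finite ?f" by (rule foldr_padd_finite) simp
  from hit_if_flags_vanish[OF k sub this van] have "?f \<in> hit k" .
  moreover have "mono_less k v u" if "v \<in> set vs" for v
  proof -
    have v: "v \<in> wmons k (Suc n)" "lex_less (sigma v) (sigma u)" using vs[OF that] by simp_all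
    then show ?thesis
      using mdeg_wmons[OF v(1)] mdeg_wmons[OF u] u unfolding mono_less_def wmons_def by simp
  qed
  ultimately have "\<exists>vs. (\<forall>v\<in>set vs. mono_less k v u) \<and> foldr padd (map (\<lambda>v. {v}) vs) {u} \<in> hit k"
    by (intro exI[of _ vs]) simp
  then show ?thesis
    unfolding admissible_def by simp
qed

text \<open>If \<open>u\<close> is least among the monomials of its weight and support with a
  certain flag, that functional is 1 on \<open>u\<close> and 0 on everything smaller: monomials of
  smaller weight have even exponents and hence no flags.\<close>

lemma admissibleI:
  assumes u: "u \<in> wmons k (Suc n)" and m: "m < k" "R = psi \<or> R = theta" "R (u ! m)"
    and min: "\<And>v. v \<in> wmons k (Suc n) \<Longrightarrow> supp v = supp u \<Longrightarrow> R (v ! m) \<Longrightarrow> \<not> lex_less (sigma v) (sigma u)"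
  shows "admissible k u"
  unfolding admissible_def
proof (intro conjI notI)
  show len: "length u = k" using u by (simp add: wmons_def)
  let ?P = "flagged (2 ^ Suc n) (supp u) m R"
  assume "\<exists>vs. (\<forall>v\<in>set vs. mono_less k v u) \<and> foldr padd (map (\<lambda>v. {v}) vs) {u} \<in> hit k"
  then obtain vs where vs: "\<forall>v\<in>set vs. mono_less k v u"
    "foldr padd (map (\<lambda>v. {v}) vs) {u} \<in> hit k"
    by (elim exE conjE) (rule that)
  have "\<not> ?P v" if v: "v \<in> set vs" for v
  proof
    assume P: "?P v"
    have less: "length v = k" "mdeg v = 2 ^ Suc n" "lex_less (wt v) \<omega> \<or> (wt v = \<omega> \<and> lex_less (sigma v) (sigma u))"
      using bspec[OF vs(1) v] u mdeg_wmons[OF u] unfolding mono_less_def wmons_def by simp_all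
    have supp: "supp v = supp u" and R: "R (v ! m)" using P by (simp_all add: flagged_def)
    from less(3) show False
    proof
      assume "lex_less (wt v) \<omega>"
      then have "even (v ! m)"
        using even_if_wt_less_omega_d[OF less(2)] less(1) m(1) by simp
      then show False
        using odd_if_flagged[OF m(2) R] by simp
    next
      assume "wt v = \<omega> \<and> lex_less (sigma v) (sigma u)"
      then show False
        using min[OF _ supp R] less(1) by (simp add: wmons_def)
    qed
  qed
  then have "filter ?P vs = []" by (auto simp: filter_empty_conv)
  moreover have "?P u" using u m(3) mdeg_wmons by (simp add: flagged_def)
  ultimately have "par ?P (foldr padd (map (\<lambda>v. {v}) vs) {u})"
    by (simp add: foldr_padd_par)
  then show False
    using hit_flagged[OF vs(2) m(1,2), of "Suc n" "supp u"] by blast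
qed

end

subsection \<open>Five variables\<close>

lemma lex_less_irrefl: "\<not> lex_less f f"
  by (simp add: lex_less_def)

lemma lex_less_asym: "lex_less f g \<Longrightarrow> \<not> lex_less g f"
proof
  assume "lex_less f g" "lex_less g f"
  then obtain m l where m: "f m < g m" "\<forall>i<m. f i = g i" and l: "g l < f l" "\<forall>i<l. g i = f i"
    by (auto simp: lex_less_def)
  then show False by (cases m l rule: linorder_cases) auto
qed

lemma sigma_lex_lessI:
  assumes "length x = k" "length y = k" "m < k" "x ! m < y ! m" "\<And>i. i < m \<Longrightarrow> x ! i = y ! i"
  shows "lex_less (sigma x) (sigma y)"
  unfolding lex_less_def sigma_def using assms by (intro exI[of _ m]) auto

text \<open>The flag \<open>psi\<close> is encoded as \<open>True\<close>, \<open>theta\<close> as \<open>False\<close>. \<open>low d b m\<close> is the lexicographically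
  least monomial of weight \<open>(2)|(1)^(d-1)\<close> with positive exponents that has flag \<open>b\<close> at \<open>m\<close> (counted
  from 0); \<open>low d True 0\<close> is a dummy.\<close>

definition low :: "nat \<Rightarrow> bool \<Rightarrow> nat \<Rightarrow> mono" where
  "low d b m = (if b
     then [[], [1, 1, 2, 4, 2 ^ d - 8], [1, 2, 1, 4, 2 ^ d - 8],
           [1, 2, 4, 1, 2 ^ d - 8], [1, 2, 4, 2 ^ d - 8, 1]] ! m
     else [[3, 1, 4, 8, 2 ^ d - 16], [1, 3, 4, 8, 2 ^ d - 16], [1, 2, 5, 8, 2 ^ d - 16],
           [1, 2, 4, 9, 2 ^ d - 16], [1, 2, 4, 8, 2 ^ d - 15]] ! m)"

definition flag :: "bool \<Rightarrow> nat \<Rightarrow> bool" where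
  "flag b = (if b then psi else theta)"

lemma less_5_cases:
  assumes "(m :: nat) < 5" obtains "m = 0" | "m = 1" | "m = 2" | "m = 3" | "m = 4"
  using assms by linarith

lemma list5_cases:
  assumes "length x = 5" obtains a b c d e where "x = [a, b, c, d, e]"
  using assms by (auto simp: numeral_eq_Suc length_Suc_conv)

lemma pos_even_ge: "0 < a \<Longrightarrow> even a \<Longrightarrow> 2 \<le> (a :: nat)"
  "0 < a \<Longrightarrow> even a \<Longrightarrow> even (a div 2) \<Longrightarrow> 4 \<le> a"
  "0 < a \<Longrightarrow> even a \<Longrightarrow> even (a div 2) \<Longrightarrow> even (a div 4) \<Longrightarrow> 8 \<le> a"
  by presburger+

lemma theta_ge: "theta a \<Longrightarrow> 3 \<le> a"
  "theta a \<Longrightarrow> even (a div 2) \<Longrightarrow> 5 \<le> a"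
  "theta a \<Longrightarrow> even (a div 2) \<Longrightarrow> even (a div 4) \<Longrightarrow> 9 \<le> a"
  unfolding theta_def by presburger+

definition posmons :: "nat \<Rightarrow> mono set" where
  "posmons d = {x \<in> wmons 5 d. supp x = {..<5}}"

context
  fixes d :: nat
  assumes d: "5 \<le> d"
begin

lemma posmons_props:
  assumes "x \<in> posmons d"
  shows "length x = 5" "mdeg x = 2 ^ d" "\<And>j. j < 5 \<Longrightarrow> 0 < x ! j"
    and "\<exists>i<5. \<exists>j<5. i \<noteq> j \<and> (\<forall>m<5. odd (x ! m) \<longleftrightarrow> m = i \<or> m = j)"
    and "\<And>i j. i < 5 \<Longrightarrow> j < 5 \<Longrightarrow> odd (x ! i div 2) \<Longrightarrow> odd (x ! j div 2) \<Longrightarrow> i = j"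
    and "\<And>i j. i < 5 \<Longrightarrow> j < 5 \<Longrightarrow> odd (x ! i div 4) \<Longrightarrow> odd (x ! j div 4) \<Longrightarrow> i = j"
proof -
  have x: "length x = 5" "wt x = omega_d d" "supp x = {..<5}" "x \<in> wmons 5 d"
    using assms by (auto simp: posmons_def wmons_def)
  show "length x = 5" by (rule x(1))
  show "mdeg x = 2 ^ d"
    using mdeg_wmons[of x 5 "d - 1"] x(4) d by simp
  show "0 < x ! j" if "j < 5" for j
  proof -
    have "j \<in> supp x" using that x(3) by simp
    then show ?thesis by (simp add: supp_def)
  qed
  have "card {j. j < 5 \<and> odd (x ! j)} = 2"
    using wt_eq_card[of x 0] x(1,2) by (simp add: omega_d_def)
  then obtain i j where ij: "{j. j < 5 \<and> odd (x ! j)} = {i, j}" "i \<noteq> j"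
    by (auto simp: card_2_iff)
  have "i < 5" "j < 5" using ij(1) by blast+
  moreover have "\<forall>m<5. odd (x ! m) \<longleftrightarrow> m = i \<or> m = j" using ij(1) by blast
  ultimately show "\<exists>i<5. \<exists>j<5. i \<noteq> j \<and> (\<forall>m<5. odd (x ! m) \<longleftrightarrow> m = i \<or> m = j)"
    using ij(2) by blast
  have unique: "i = j" if "t = 1 \<or> t = 2" "i < 5" "j < 5" "odd (x ! i div 2 ^ t)" "odd (x ! j div 2 ^ t)" for i j t
  proof -
    have "card {j. j < 5 \<and> odd (x ! j div 2 ^ t)} = 1"
    proof -
      have "omega_d d t = 1" using that(1) d by (auto simp: omega_d_def)
      then show ?thesis using wt_eq_card[of x t] x(1,2) by simp
    qed
    then obtain a where a: "{j. j < 5 \<and> odd (x ! j div 2 ^ t)} = {a}"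
      unfolding card_1_singleton_iff One_nat_def by (rule exE)
    have "i \<in> {a}" "j \<in> {a}"
      unfolding a[symmetric] using that(2-5) by simp_all
    then show ?thesis by simp
  qed
  show "i = j" if "i < 5" "j < 5" "odd (x ! i div 2)" "odd (x ! j div 2)" for i j
    using unique[of 1 i j] that by simp
  show "i = j" if "i < 5" "j < 5" "odd (x ! i div 4)" "odd (x ! j div 4)" for i j
    using unique[of 2 i j] that by simp
qed

lemma not_three_odd:
  assumes "x \<in> posmons d" "i < 5" "j < 5" "l < 5" "i \<noteq> j" "i \<noteq> l" "j \<noteq> l" "odd (x ! i)" "odd (x ! j)"
  shows "even (x ! l)"
proof -
  obtain p q where "\<forall>m<5. odd (x ! m) \<longleftrightarrow> m = p \<or> m = q"
    using posmons_props(4)[OF assms(1)] by blast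
  then show ?thesis
    using assms(2-) by (cases "i = p"; cases "j = p") auto
qed

text \<open>The last exponent is determined by the degree, so four bounds suffice, each only where
  the earlier exponents agree.\<close>

lemma lex5:
  assumes "a + b + c + e + f = a' + b' + c' + e' + (f' :: nat)"
    and "a' \<le> a" "a = a' \<Longrightarrow> b' \<le> b" "a = a' \<Longrightarrow> b = b' \<Longrightarrow> c' \<le> c"
    "a = a' \<Longrightarrow> b = b' \<Longrightarrow> c = c' \<Longrightarrow> e' \<le> e"
  shows "[a, b, c, e, f] = [a', b', c', e', f'] \<or>
    lex_less (sigma [a', b', c', e', f']) (sigma [a, b, c, e, f])"
proof -
  have I: "lex_less (sigma [a', b', c', e', f']) (sigma [a, b, c, e, f])"
    if "m < 5" "[a', b', c', e', f'] ! m < [a, b, c, e, f] ! m"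
      "\<forall>i\<in>{..<m}. [a', b', c', e', f'] ! i = [a, b, c, e, f] ! i" for m
    by (rule sigma_lex_lessI[of _ 5 _ m]) (use that in simp_all)
  have L: "{..<Suc 0} = {0 :: nat}" "{..<2} = {0, 1 :: nat}" "{..<3} = {0, 1, 2 :: nat}"
    by auto
  show ?thesis
  proof (cases "a = a'")
    case a: True
    show ?thesis
    proof (cases "b = b'")
      case b: True
      show ?thesis
      proof (cases "c = c'")
        case c: True
        show ?thesis
        proof (cases "e = e'")
          case True
          then show ?thesis using assms(1) a b c by simp
        next
          case False
          with assms(5)[OF a b c] have "e' < e" by simp
          then show ?thesis using I[of 3] a b c by (simp add: L)
        qed
      next
        case False
        with assms(4)[OF a b] have "c' < c" by simp
        then show ?thesis using I[of 2] a b by (simp add: L)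
      qed
    next
      case False
      with assms(3)[OF a] have "b' < b" by simp
      then show ?thesis using I[of 1] a by (simp add: L)
    qed
  next
    case False
    with assms(2) have "a' < a" by simp
    then show ?thesis using I[of 0] by simp
  qed
qed

lemma two_pow_ge: "32 \<le> (2 :: nat) ^ d"
  using power_increasing[OF d, of "2 :: nat"] by simp

text \<open>Greedy minimization from the left. A binary digit 2 or 4 used by an earlier exponent is
  no longer available, so a later positive even exponent must be at least the next power of 2, and a
  later \<open>theta\<close> exponent at least that power plus 1. Once two exponents are odd, all
  others are even.\<close>

lemma low_minimal:
  assumes u: "u \<in> posmons d" and m: "m < 5" "b \<longrightarrow> m \<noteq> 0" and fl: "flag b (u ! m)"
  shows "u = low d b m \<or> lex_less (sigma (low d b m)) (sigma u)"
proof -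
  note p = posmons_props[OF u]
  obtain x0 x1 x2 x3 x4 where U: "u = [x0, x1, x2, x3, x4]"
    using list5_cases[OF p(1)] by blast
  have sum: "x0 + x1 + x2 + x3 + x4 = 2 ^ d"
    using p(2) by (simp add: U mdeg_def)
  have pos: "0 < x0" "0 < x1" "0 < x2" "0 < x3" "0 < x4"
    using p(3)[of 0] p(3)[of 1] p(3)[of 2] p(3)[of 3] p(3)[of 4] by (simp_all add: U)
  have nths: "u ! 0 = x0" "u ! 1 = x1" "u ! Suc 0 = x1" "u ! 2 = x2" "u ! 3 = x3" "u ! 4 = x4"
    by (simp_all add: U)
  have o1: "odd x0 \<longrightarrow> odd x1 \<longrightarrow> even x2 \<and> even x3 \<and> even x4"
    using not_three_odd[OF u, of 0 1 2] not_three_odd[OF u, of 0 1 3] not_three_odd[OF u, of 0 1 4] by (simp add: nths)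
  have o2: "odd x0 \<longrightarrow> odd x2 \<longrightarrow> even x1 \<and> even x3 \<and> even x4"
    using not_three_odd[OF u, of 0 2 1] not_three_odd[OF u, of 0 2 3] not_three_odd[OF u, of 0 2 4] by (simp add: nths)
  have o3: "odd x0 \<longrightarrow> odd x3 \<longrightarrow> even x1 \<and> even x2 \<and> even x4"
    using not_three_odd[OF u, of 0 3 1] not_three_odd[OF u, of 0 3 2] not_three_odd[OF u, of 0 3 4] by (simp add: nths)
  have o4: "odd x0 \<longrightarrow> odd x4 \<longrightarrow> even x1 \<and> even x2 \<and> even x3"
    using not_three_odd[OF u, of 0 4 1] not_three_odd[OF u, of 0 4 2] not_three_odd[OF u, of 0 4 3] by (simp add: nths)
  note odd3 = o1 o2 o3 o4
  have bit1: "odd (x0 div 2) \<longrightarrow> even (x1 div 2) \<and> even (x2 div 2) \<and> even (x3 div 2)"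
    "odd (x1 div 2) \<longrightarrow> even (x2 div 2) \<and> even (x3 div 2)" "odd (x2 div 2) \<longrightarrow> even (x3 div 2)"
    using p(5)[of 0 1] p(5)[of 0 2] p(5)[of 0 3] p(5)[of 1 2] p(5)[of 1 3] p(5)[of 2 3]
    by (simp_all add: nths) blast+
  have bit2: "odd (x2 div 4) \<longrightarrow> even (x3 div 4)"
    using p(6)[of 2 3] by (simp add: nths) blast
  have e1: "2 \<le> x1" if "even x1"
    by (rule pos_even_ge(1)[OF pos(2) that])
  have e2: "4 \<le> x2" if "even x2" "odd (x0 div 2) \<or> odd (x1 div 2)"
  proof -
    have "even (x2 div 2)" using that(2) bit1(1,2) by blast
    then show ?thesis by (rule pos_even_ge(2)[OF pos(3) that(1)])
  qed
  have e2': "2 \<le> x2" if "even x2"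
    by (rule pos_even_ge(1)[OF pos(3) that])
  have e3: "8 \<le> x3" if "even x3" "odd (x0 div 2) \<or> odd (x1 div 2)" "odd (x2 div 4)"
  proof -
    have "even (x3 div 2)" using that(2) bit1(1,2) by blast
    moreover have "even (x3 div 4)" using that(3) bit2 by blast
    ultimately show ?thesis by (rule pos_even_ge(3)[OF pos(4) that(1)])
  qed
  have e3': "4 \<le> x3" if "even x3" "odd (x1 div 2) \<or> odd (x2 div 2)"
  proof -
    have "even (x3 div 2)" using that(2) bit1(2,3) by blast
    then show ?thesis by (rule pos_even_ge(2)[OF pos(4) that(1)])
  qed
  have t2: "5 \<le> x2" if "theta x2" "odd (x1 div 2)"
  proof -
    have "even (x2 div 2)" using that(2) bit1(2) by blast
    then show ?thesis by (rule theta_ge(2)[OF that(1)])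
  qed
  have t3: "9 \<le> x3" if "theta x3" "odd (x1 div 2)" "odd (x2 div 4)"
  proof -
    have "even (x3 div 2)" using that(2) bit1(2) by blast
    moreover have "even (x3 div 4)" using that(3) bit2 by blast
    ultimately show ?thesis by (rule theta_ge(3)[OF that(1)])
  qed
  have odd_theta: "theta a \<Longrightarrow> odd a" for a by (simp add: theta_def)
  have "m = 0 \<or> m = 1 \<or> m = 2 \<or> m = 3 \<or> m = 4" using m(1) by linarith
  then consider "b" "m = 1" | "b" "m = 2" | "b" "m = 3" | "b" "m = 4" | "\<not> b" "m = 0"
    | "\<not> b" "m = 1" | "\<not> b" "m = 2" | "\<not> b" "m = 3" | "\<not> b" "m = 4"
    using m(2) by blast
  then show ?thesis
  proof cases
    case 1
    have f: "x1 = 1" using fl 1 by (simp add: flag_def psi_def nths)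
    have o: "odd x1" using f by simp
    have low: "low d b m = [1, 1, 2, 4, 2 ^ d - 8]" using 1 by (simp add: low_def)
    show ?thesis
      unfolding U low
    proof (rule lex5)
      show "x0 + x1 + x2 + x3 + x4 = 1 + 1 + 2 + 4 + (2 ^ d - 8)"
        using sum two_pow_ge by linarith
      show "1 \<le> x0" using pos(1) by simp
      show "1 \<le> x1" if "x0 = 1" using pos(2) by simp
      show "2 \<le> x2" if "x0 = 1" "x1 = 1"
        by (rule e2') (use that o odd3(1) in simp_all)
      show "4 \<le> x3" if "x0 = 1" "x1 = 1" "x2 = 2"
        by (rule e3') (use that o odd3(1) in simp_all)
    qed
  next
    case 2
    have f: "x2 = 1" using fl 2 by (simp add: flag_def psi_def nths)
    have o: "odd x2" using f by simp
    have low: "low d b m = [1, 2, 1, 4, 2 ^ d - 8]" using 2 by (simp add: low_def)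
    show ?thesis
      unfolding U low
    proof (rule lex5)
      show "x0 + x1 + x2 + x3 + x4 = 1 + 2 + 1 + 4 + (2 ^ d - 8)"
        using sum two_pow_ge by linarith
      show "1 \<le> x0" using pos(1) by simp
      show "2 \<le> x1" if "x0 = 1"
        by (rule e1) (use that o odd3(2) in simp_all)
      show "1 \<le> x2" if "x0 = 1" "x1 = 2" using pos(3) by simp
      show "4 \<le> x3" if "x0 = 1" "x1 = 2" "x2 = 1"
        by (rule e3') (use that o odd3(2) in simp_all)
    qed
  next
    case 3
    have f: "x3 = 1" using fl 3 by (simp add: flag_def psi_def nths)
    have o: "odd x3" using f by simp
    have low: "low d b m = [1, 2, 4, 1, 2 ^ d - 8]" using 3 by (simp add: low_def)
    show ?thesis
      unfolding U low
    proof (rule lex5)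
      show "x0 + x1 + x2 + x3 + x4 = 1 + 2 + 4 + 1 + (2 ^ d - 8)"
        using sum two_pow_ge by linarith
      show "1 \<le> x0" using pos(1) by simp
      show "2 \<le> x1" if "x0 = 1"
        by (rule e1) (use that o odd3(3) in simp_all)
      show "4 \<le> x2" if "x0 = 1" "x1 = 2"
        by (rule e2) (use that o odd3(3) in simp_all)
      show "1 \<le> x3" if "x0 = 1" "x1 = 2" "x2 = 4" using pos(4) by simp
    qed
  next
    case 4
    have f: "x4 = 1" using fl 4 by (simp add: flag_def psi_def nths)
    have o: "odd x4" using f by simp
    have low: "low d b m = [1, 2, 4, 2 ^ d - 8, 1]" using 4 by (simp add: low_def)
    show ?thesis
      unfolding U low
    proof (rule lex5)
      show "x0 + x1 + x2 + x3 + x4 = 1 + 2 + 4 + (2 ^ d - 8) + 1"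
        using sum two_pow_ge by linarith
      show "1 \<le> x0" using pos(1) by simp
      show "2 \<le> x1" if "x0 = 1"
        by (rule e1) (use that o odd3(4) in simp_all)
      show "4 \<le> x2" if "x0 = 1" "x1 = 2"
        by (rule e2) (use that o odd3(4) in simp_all)
      \<comment> \<open>With the last exponent fixed to 1 by the flag, the degree forces this
        one.\<close>
      show "2 ^ d - 8 \<le> x3" if "x0 = 1" "x1 = 2" "x2 = 4" using sum that f by simp
    qed
  next
    case 5
    have f: "theta x0" using fl 5 by (simp add: flag_def nths)
    have o: "odd x0" using f by (rule odd_theta)
    have low: "low d b m = [3, 1, 4, 8, 2 ^ d - 16]" using 5 by (simp add: low_def)
    show ?thesis
      unfolding U low
    proof (rule lex5)
      show "x0 + x1 + x2 + x3 + x4 = 3 + 1 + 4 + 8 + (2 ^ d - 16)"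
        using sum two_pow_ge by linarith
      show "3 \<le> x0" using theta_ge(1)[OF f] by simp
      show "1 \<le> x1" if "x0 = 3" using pos(2) by simp
      show "4 \<le> x2" if "x0 = 3" "x1 = 1"
        by (rule e2) (use that o odd3(1) in simp_all)
      show "8 \<le> x3" if "x0 = 3" "x1 = 1" "x2 = 4"
        by (rule e3) (use that o odd3(1) in simp_all)
    qed
  next
    case 6
    have f: "theta x1" using fl 6 by (simp add: flag_def nths)
    have o: "odd x1" using f by (rule odd_theta)
    have low: "low d b m = [1, 3, 4, 8, 2 ^ d - 16]" using 6 by (simp add: low_def)
    show ?thesis
      unfolding U low
    proof (rule lex5)
      show "x0 + x1 + x2 + x3 + x4 = 1 + 3 + 4 + 8 + (2 ^ d - 16)"
        using sum two_pow_ge by linarith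
      show "1 \<le> x0" using pos(1) by simp
      show "3 \<le> x1" if "x0 = 1" using theta_ge(1)[OF f] that by simp
      show "4 \<le> x2" if "x0 = 1" "x1 = 3"
        by (rule e2) (use that o odd3(1) in simp_all)
      show "8 \<le> x3" if "x0 = 1" "x1 = 3" "x2 = 4"
        by (rule e3) (use that o odd3(1) in simp_all)
    qed
  next
    case 7
    have f: "theta x2" using fl 7 by (simp add: flag_def nths)
    have o: "odd x2" using f by (rule odd_theta)
    have low: "low d b m = [1, 2, 5, 8, 2 ^ d - 16]" using 7 by (simp add: low_def)
    show ?thesis
      unfolding U low
    proof (rule lex5)
      show "x0 + x1 + x2 + x3 + x4 = 1 + 2 + 5 + 8 + (2 ^ d - 16)"
        using sum two_pow_ge by linarith
      show "1 \<le> x0" using pos(1) by simp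
      show "2 \<le> x1" if "x0 = 1"
        by (rule e1) (use that o odd3(2) in simp_all)
      show "5 \<le> x2" if "x0 = 1" "x1 = 2" using t2[OF f] that by simp
      show "8 \<le> x3" if "x0 = 1" "x1 = 2" "x2 = 5"
        by (rule e3) (use that o odd3(2) in simp_all)
    qed
  next
    case 8
    have f: "theta x3" using fl 8 by (simp add: flag_def nths)
    have o: "odd x3" using f by (rule odd_theta)
    have low: "low d b m = [1, 2, 4, 9, 2 ^ d - 16]" using 8 by (simp add: low_def)
    show ?thesis
      unfolding U low
    proof (rule lex5)
      show "x0 + x1 + x2 + x3 + x4 = 1 + 2 + 4 + 9 + (2 ^ d - 16)"
        using sum two_pow_ge by linarith
      show "1 \<le> x0" using pos(1) by simp
      show "2 \<le> x1" if "x0 = 1"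
        by (rule e1) (use that o odd3(3) in simp_all)
      show "4 \<le> x2" if "x0 = 1" "x1 = 2"
        by (rule e2) (use that o odd3(3) in simp_all)
      show "9 \<le> x3" if "x0 = 1" "x1 = 2" "x2 = 4" using t3[OF f] that by simp
    qed
  next
    case 9
    have f: "theta x4" using fl 9 by (simp add: flag_def nths)
    have o: "odd x4" using f by (rule odd_theta)
    have low: "low d b m = [1, 2, 4, 8, 2 ^ d - 15]" using 9 by (simp add: low_def)
    show ?thesis
      unfolding U low
    proof (rule lex5)
      show "x0 + x1 + x2 + x3 + x4 = 1 + 2 + 4 + 8 + (2 ^ d - 15)"
        using sum two_pow_ge by linarith
      show "1 \<le> x0" using pos(1) by simp
      show "2 \<le> x1" if "x0 = 1"
        by (rule e1) (use that o odd3(4) in simp_all)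
      show "4 \<le> x2" if "x0 = 1" "x1 = 2"
        by (rule e2) (use that o odd3(4) in simp_all)
      show "8 \<le> x3" if "x0 = 1" "x1 = 2" "x2 = 4"
        by (rule e3) (use that o odd3(4) in simp_all)
    qed
  qed
qed

end

section \<open>Reduction to the nine monomials\<close>

lemma flag_cases: "R = psi \<or> R = theta \<longleftrightarrow> (\<exists>b. R = flag b)"
  by (auto simp: flag_def split: if_splits)

lemma wexp_replicate: "wexp (replicate r a) m = (if m = a then 2 ^ r - 1 else 0)"
proof (induction r)
  case (Suc r)
  obtain q where "2 ^ r = Suc q"
    using not0_implies_Suc[of "2 ^ r"] by auto
  then show ?case using Suc by simp
qed simp

text \<open>The flags of the monomials in \<open>reduct d b i\<close> add up to the flag \<open>b\<close> at \<open>i\<close> plus the flag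
  \<open>psi\<close> at 0, so a monomial with flags \<open>b\<close> at \<open>i\<close> and \<open>c\<close> at \<open>j\<close> is congruent to
  the sum of \<open>reduct d b i @ reduct d c j\<close>.\<close>

definition reduct :: "nat \<Rightarrow> bool \<Rightarrow> nat \<Rightarrow> mono list" where
  "reduct d b i = (if b \<and> i = 0 then [] else if \<not> b \<and> i = 0 then [low d False 0, low d True 1] else [low d b i])"

context
  fixes d :: nat
  assumes d: "5 \<le> d"
begin

text \<open>One letter fills the tail of the word; its powers from 8 or 16 up to
  \<open>2 ^ (d - 1)\<close> add up to \<open>2 ^ d - 8\<close> or
  \<open>2 ^ d - 16\<close>.\<close>

lemma low_eq_pmon:
  "low d True 1 = pmon 5 0 1 ([2, 3] @ replicate (d - 3) 4)"
  "low d True 2 = pmon 5 0 2 ([1, 3] @ replicate (d - 3) 4)"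
  "low d True 3 = pmon 5 0 3 ([1, 2] @ replicate (d - 3) 4)"
  "low d True 4 = pmon 5 0 4 ([1, 2] @ replicate (d - 3) 3)"
  "low d False 0 = pmon 5 0 1 ([0, 2, 3] @ replicate (d - 4) 4)"
  "low d False 1 = pmon 5 0 1 ([1, 2, 3] @ replicate (d - 4) 4)"
  "low d False 2 = pmon 5 0 2 ([1, 2, 3] @ replicate (d - 4) 4)"
  "low d False 3 = pmon 5 0 3 ([1, 2, 3] @ replicate (d - 4) 4)"
  "low d False 4 = pmon 5 0 4 ([1, 2, 3] @ replicate (d - 4) 4)"
proof -
  obtain e where e: "d = e + 5" using d le_Suc_ex by (metis add.commute)
  have q: "(2 :: nat) ^ d = 32 * 2 ^ e" "(2 :: nat) ^ (d - 3) = 4 * 2 ^ e" "(2 :: nat) ^ (d - 4) = 2 * 2 ^ e"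
    unfolding e by (simp_all add: power_add)
  have upt: "[0..<5] = [0, 1, 2, 3, 4 :: nat]" by (simp add: upt_rec)
  obtain r where r: "(2 :: nat) ^ e = Suc r"
    using not0_implies_Suc[of "2 ^ e"] by auto
  show "low d True 1 = pmon 5 0 1 ([2, 3] @ replicate (d - 3) 4)"
    "low d True 2 = pmon 5 0 2 ([1, 3] @ replicate (d - 3) 4)"
    "low d True 3 = pmon 5 0 3 ([1, 2] @ replicate (d - 3) 4)"
    "low d True 4 = pmon 5 0 4 ([1, 2] @ replicate (d - 3) 3)"
    "low d False 0 = pmon 5 0 1 ([0, 2, 3] @ replicate (d - 4) 4)"
    "low d False 1 = pmon 5 0 1 ([1, 2, 3] @ replicate (d - 4) 4)"
    "low d False 2 = pmon 5 0 2 ([1, 2, 3] @ replicate (d - 4) 4)"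
    "low d False 3 = pmon 5 0 3 ([1, 2, 3] @ replicate (d - 4) 4)"
    "low d False 4 = pmon 5 0 4 ([1, 2, 3] @ replicate (d - 4) 4)"
    unfolding pmon_def upt low_def q r by (simp_all add: wexp_replicate q r)
qed

lemma low_in_posmons:
  assumes "m < 5" "b \<longrightarrow> m \<noteq> 0"
  shows "low d b m \<in> posmons d"
proof -
  have I: "pmon 5 i j ws \<in> posmons d"
    if "i < 5" "j < 5" "i \<noteq> j" "length ws = d - 1" "set ws \<subseteq> {..<5}" "{i, j} \<union> set ws = {..<5}" for i j ws
  proof -
    have "Suc (d - 1) = d" using d by simp
    then show ?thesis
      using pmon_in_wmons[OF that(1-3,5,4)] supp_pmon[OF that(1,2,5)] that(6) by (simp add: posmons_def)
  qed
  have L: "{..<5} = {0, 1, 2, 3, 4 :: nat}" by auto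
  have r: "set (replicate (d - 3) a) = {a}" "set (replicate (d - 4) a) = {a}" for a :: nat
    using d by simp_all
  have "m = 0 \<or> m = 1 \<or> m = 2 \<or> m = 3 \<or> m = 4" using assms(1) by linarith
  then consider "b" "m = 1" | "b" "m = 2" | "b" "m = 3" | "b" "m = 4" | "\<not> b" "m = 0"
    | "\<not> b" "m = 1" | "\<not> b" "m = 2" | "\<not> b" "m = 3" | "\<not> b" "m = 4"
    using assms(2) by blast
  then show ?thesis
  proof cases
    case 1
    then show ?thesis using d by (simp only: low_eq_pmon simp_thms) (rule I; auto simp: L r)
  next
    case 2
    then show ?thesis using d by (simp only: low_eq_pmon simp_thms) (rule I; auto simp: L r)
  next
    case 3
    then show ?thesis using d by (simp only: low_eq_pmon simp_thms) (rule I; auto simp: L r)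
  next
    case 4
    then show ?thesis using d by (simp only: low_eq_pmon simp_thms) (rule I; auto simp: L r)
  next
    case 5
    then show ?thesis using d by (simp only: low_eq_pmon simp_thms) (rule I; auto simp: L r)
  next
    case 6
    then show ?thesis using d by (simp only: low_eq_pmon simp_thms) (rule I; auto simp: L r)
  next
    case 7
    then show ?thesis using d by (simp only: low_eq_pmon simp_thms) (rule I; auto simp: L r)
  next
    case 8
    then show ?thesis using d by (simp only: low_eq_pmon simp_thms) (rule I; auto simp: L r)
  next
    case 9
    then show ?thesis using d by (simp only: low_eq_pmon simp_thms) (rule I; auto simp: L r)
  qed
qed

text \<open>\<open>reduct d b i\<close> is the path in the tree from the flag \<open>b\<close> at
  \<open>i\<close> to the root, \<open>psi\<close> at 0, and interior vertices of a path are counted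
  twice.\<close>

lemma odd_length_filter_reduct:
  assumes "i < 5" "m < 5"
  shows "odd (length (filter (\<lambda>x. flag c (x ! m)) (reduct d b i))) \<longleftrightarrow>
    ((c \<longleftrightarrow> b) \<and> m = i) \<noteq> (c \<and> m = 0)"
proof -
  define p :: nat where "p = 2 ^ d"
  have p: "32 \<le> p" using two_pow_ge[OF d] by (simp add: p_def)
  moreover have "even p" using d by (simp add: p_def)
  \<comment> \<open>Of the exponents depending on \<open>d\<close> only \<open>2 ^ d - 15\<close> is
    odd, and it exceeds 1.\<close>
  ultimately have P: "psi (p - 8) = False" "theta (p - 8) = False" "psi (p - 16) = False"
    "theta (p - 16) = False" "psi (p - 15) = False" "theta (p - 15) = True"
    by (auto simp: psi_def theta_def)
  have N: "psi 1" "psi (Suc 0)" "\<not> psi 2" "\<not> psi 3" "\<not> psi 4" "\<not> psi 5" "\<not> psi 8" "\<not> psi 9"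
    "\<not> theta 1" "\<not> theta (Suc 0)" "\<not> theta 2" "theta 3" "\<not> theta 4" "theta 5" "\<not> theta 8" "theta 9"
    by (auto simp: psi_def theta_def)
  show ?thesis
    by (rule less_5_cases[OF assms(1)]; rule less_5_cases[OF assms(2)]; cases b; cases c)
      (simp_all add: reduct_def low_def flag_def P N p_def[symmetric])
qed

lemma low_admissible:
  assumes "m < 5" "b \<longrightarrow> m \<noteq> 0" "flag b (low d b m ! m)"
  shows "admissible 5 (low d b m)"
proof -
  interpret cls_context 5 "d - 1" by unfold_locales (use d in simp)
  have d1: "Suc (d - 1) = d" using d by simp
  have low: "low d b m \<in> wmons 5 d" "supp (low d b m) = {..<5}"
    using low_in_posmons[OF assms(1,2)] by (simp_all add: posmons_def)
  show ?thesis
  proof (rule admissibleI[of _ m "flag b", unfolded d1])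
    show "low d b m \<in> wmons 5 d" by (rule low(1))
    show "flag b = psi \<or> flag b = theta" unfolding flag_cases by blast
  next
    fix v assume "v \<in> wmons 5 d" "supp v = supp (low d b m)" "flag b (v ! m)"
    then have "v = low d b m \<or> lex_less (sigma (low d b m)) (sigma v)"
      using low_minimal[OF d _ assms(1,2)] low(2) by (simp add: posmons_def)
    then show "\<not> lex_less (sigma v) (sigma (low d b m))"
      using lex_less_irrefl lex_less_asym by metis
  qed (use assms in simp_all)
qed

text \<open>The edge \<open>x\<close> is the sum of the paths from its two ends to the root. The
  members of these paths are smaller than \<open>x\<close>, because \<open>x\<close> carries the
  flags at whose minima they lie without being one of these minima.\<close>

lemma not_admissible_if_not_low:
  assumes x: "x \<in> posmons d" and nl: "\<And>b m. m < 5 \<Longrightarrow> b \<longrightarrow> m \<noteq> 0 \<Longrightarrow> x \<noteq> low d b m"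
  shows "\<not> admissible 5 x"
proof -
  interpret cls_context 5 "d - 1" by unfold_locales (use d in simp)
  have d1: "Suc (d - 1) = d" using d by simp
  obtain i j where ij: "i < 5" "j < 5" "i \<noteq> j" "\<forall>m<5. odd (x ! m) \<longleftrightarrow> m = i \<or> m = j"
    using posmons_props(4)[OF d x] by blast
  define f where "f m = (x ! m = 1)" for m
  have flag_iff: "flag c (x ! m) \<longleftrightarrow> (m = i \<or> m = j) \<and> (c \<longleftrightarrow> f m)" if "m < 5" for c m
    using ij(4) that by (auto simp: flag_def psi_def theta_def f_def)
  have red: "v \<in> wmons 5 d \<and> supp v = supp x \<and> lex_less (sigma v) (sigma x)"
    if v: "v \<in> set (reduct d (f l) l)" and l: "l = i \<or> l = j" for v l
  proof -
    have l5: "l < 5" using l ij by blast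
    have low: "low d b m \<in> wmons 5 d \<and> supp (low d b m) = supp x" if "m < 5" "b \<longrightarrow> m \<noteq> 0" for b m
      using low_in_posmons[OF that] x by (simp add: posmons_def)
    have fl: "flag (f l) (x ! l)" using flag_iff[OF l5] l by simp
    have less: "lex_less (sigma (low d (f l) l)) (sigma x)" if "f l \<longrightarrow> l \<noteq> 0"
      using low_minimal[OF d x l5 that fl] nl[OF l5 that] by blast
    consider "f l \<longrightarrow> l \<noteq> 0" "v = low d (f l) l" | "\<not> f l" "l = 0" "v = low d True 1"
      using v by (auto simp: reduct_def split: if_splits)
    then show ?thesis
    proof cases
      case 1
      then show ?thesis using low[OF l5 1(1)] less by simp
    next
      case 2
      \<comment> \<open>The one path of length two: its edge \<open>low d True 1\<close> need not
        share a flag with \<open>x\<close>, but starts with exponent 1.\<close>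
      have "3 \<le> x ! 0" using theta_ge(1)[of "x ! 0"] fl 2 by (simp add: flag_def)
      then have "lex_less (sigma (low d True 1)) (sigma x)"
        using posmons_props(1)[OF d x]
        by (intro sigma_lex_lessI[of _ 5 _ 0]) (simp_all add: low_def)
      then show ?thesis using 2(3) low[of 1 True] by simp
    qed
  qed
  have ev: "even (length (filter (\<lambda>y. R (y ! m)) (x # reduct d (f i) i @ reduct d (f j) j)))"
    if m: "m < 5" and R: "R = psi \<or> R = theta" for m R
  proof -
    obtain c where c: "R = flag c" using R flag_cases by blast
    have "even (length (filter (\<lambda>y. R (y ! m)) (x # reduct d (f i) i @ reduct d (f j) j))) \<longleftrightarrow>
      (flag c (x ! m) \<longleftrightarrow> (odd (length (filter (\<lambda>y. flag c (y ! m)) (reduct d (f i) i)))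
        \<noteq> odd (length (filter (\<lambda>y. flag c (y ! m)) (reduct d (f j) j)))))"
      by (auto simp: c)
    then show ?thesis
      unfolding odd_length_filter_reduct[OF ij(1) m] odd_length_filter_reduct[OF ij(2) m]
        flag_iff[OF m] using ij(3) by blast
  qed
  show ?thesis
  proof (rule not_admissibleI[of x "reduct d (f i) i @ reduct d (f j) j", unfolded d1, OF d _ _ ev])
    show "x \<in> wmons 5 d" using x by (simp add: posmons_def)
  next
    fix v assume "v \<in> set (reduct d (f i) i @ reduct d (f j) j)"
    then show "v \<in> wmons 5 d \<and> supp v = supp x \<and> lex_less (sigma v) (sigma x)"
      using red by auto
  qed
qed

end

lemma sum_Pow_card:
  fixes g :: "nat \<Rightarrow> nat"
  assumes "finite A"
  shows "(\<Sum>T | T \<subseteq> A \<and> 2 \<le> card T. g (card T)) = (\<Sum>c\<in>{2..card A}. (card A choose c) * g c)"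
proof -
  let ?S = "{T. T \<subseteq> A \<and> 2 \<le> card T}"
  have "finite ?S"
    by (rule finite_subset[of _ "Pow A"]) (use assms in auto)
  then have "(\<Sum>T\<in>?S. g (card T)) = (\<Sum>c\<in>{2..card A}. \<Sum>T\<in>{T \<in> ?S. card T = c}. g (card T))"
    by (intro sum.group[symmetric]) (use card_mono[OF assms] in auto)
  also have "\<dots> = (\<Sum>c\<in>{2..card A}. (card A choose c) * g c)"
  proof (rule sum.cong[OF refl])
    fix c assume "c \<in> {2..card A}"
    then have "{T \<in> ?S. card T = c} = {T. T \<subseteq> A \<and> card T = c}" by auto
    then show "(\<Sum>T\<in>{T \<in> ?S. card T = c}. g (card T)) = (card A choose c) * g c"
      using n_subsets[OF assms, of c] by simp
  qed
  finally show ?thesis .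
qed

theorem theorem3p3:
  fixes d :: nat
  assumes "5 \<le> d"
  shows "{x. length x = 5 \<and> wt x = omega_d d \<and> (\<forall>j<5. 0 < x ! j) \<and> admissible 5 x}
           = {[1, 1, 2, 4, 2^d - 8],
              [1, 2, 1, 4, 2^d - 8],
              [1, 2, 4, 1, 2^d - 8],
              [1, 2, 4, 2^d - 8, 1],
              [1, 2, 4, 8, 2^d - 15],
              [1, 2, 4, 9, 2^d - 16],
              [1, 2, 5, 8, 2^d - 16],
              [1, 3, 4, 8, 2^d - 16],
              [3, 1, 4, 8, 2^d - 16]}
         \<and> dim_QP_plus 5 (omega_d d) = 9
         \<and> dim_QP 5 (omega_d d) = 124"
proof (intro conjI)
  let ?A = "{x. length x = 5 \<and> wt x = omega_d d \<and> (\<forall>j<5. 0 < x ! j) \<and> admissible 5 x}"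
  interpret cls_context 5 "d - 1" by unfold_locales (use assms in simp)
  have d1: "Suc (d - 1) = d" using assms by simp
  show "dim_QP_plus 5 (omega_d d) = 9"
    using dim_QP_plus_eq assms by (simp add: d1)
  have "dim_QP 5 (omega_d d) = (\<Sum>c\<in>{2..5}. (5 choose c) * (2 * c - 1))"
    using dim_QP_eq sum_Pow_card[of "{..<5 :: nat}" "\<lambda>c. 2 * c - 1"] assms by (simp add: d1)
  also have "{2..5} = {2, 3, 4, 5 :: nat}" by auto
  \<comment> \<open>By size of the support: 10 * 3 + 10 * 5 + 5 * 7 + 1 * 9.\<close>
  also have "(\<Sum>c\<in>{2, 3, 4, 5}. (5 choose c) * (2 * c - 1)) = (124 :: nat)"
    by (simp add: eval_nat_numeral)
  finally show "dim_QP 5 (omega_d d) = 124" .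
  have pos: "x \<in> posmons d \<longleftrightarrow> length x = 5 \<and> wt x = omega_d d \<and> (\<forall>j<5. 0 < x ! j)" for x
    by (auto simp: posmons_def wmons_def supp_def)
  have low: "low d b m \<in> ?A" if "m < 5" "b \<longrightarrow> m \<noteq> 0" "flag b (low d b m ! m)" for b m
    using low_in_posmons[OF assms that(1,2)] low_admissible[OF assms that] pos by simp
  have p: "(32 :: nat) \<le> 2 ^ d" "even ((2 :: nat) ^ d)" using two_pow_ge[OF assms] assms by auto
  let ?L = "{low d True 1, low d True 2, low d True 3, low d True 4, low d False 4, low d False 3,
    low d False 2, low d False 1, low d False 0}"
  have "?A = ?L"
  proof (rule equalityI)
    show "?L \<subseteq> ?A"
      using p by (intro insert_subsetI empty_subsetI low)
        (auto simp: low_def flag_def psi_def theta_def)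
    show "?A \<subseteq> ?L"
    proof
      fix x assume x: "x \<in> ?A"
      show "x \<in> ?L"
      proof (rule ccontr)
        assume nL: "x \<notin> ?L"
        have "x \<noteq> low d b m" if "m < 5" "b \<longrightarrow> m \<noteq> 0" for b m
        proof -
          have "m = 0 \<or> m = 1 \<or> m = 2 \<or> m = 3 \<or> m = 4" using that(1) by linarith
          then have "low d b m \<in> ?L" using that(2) by (cases b) auto
          then show ?thesis using nL by metis
        qed
        then show False
          using not_admissible_if_not_low[OF assms, of x] x pos by blast
      qed
    qed
  qed
  also have "?L = {[1, 1, 2, 4, 2^d - 8], [1, 2, 1, 4, 2^d - 8], [1, 2, 4, 1, 2^d - 8],
    [1, 2, 4, 2^d - 8, 1], [1, 2, 4, 8, 2^d - 15], [1, 2, 4, 9, 2^d - 16], [1, 2, 5, 8, 2^d - 16],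
    [1, 3, 4, 8, 2^d - 16], [3, 1, 4, 8, 2^d - 16]}"
    by (simp add: low_def)
  finally show "?A = {[1, 1, 2, 4, 2^d - 8], [1, 2, 1, 4, 2^d - 8], [1, 2, 4, 1, 2^d - 8],
    [1, 2, 4, 2^d - 8, 1], [1, 2, 4, 8, 2^d - 15], [1, 2, 4, 9, 2^d - 16], [1, 2, 5, 8, 2^d - 16],
    [1, 3, 4, 8, 2^d - 16], [3, 1, 4, 8, 2^d - 16]}" .
qed


end
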